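(* For every finite simple graph $G$, $$\Delta(G)=T^-(G)\leq M(G)\leq Z(G)\leq T^+(G)\leq \Delta^+(G),$$ and moreover $T^-(G)=M(G)=T^+(G)$ if $G$ is a forest.
   Context: Graphs are finite and simple. For a real symmetric $n\times n$ matrix $A=[a_{ij}]$, the graph of $A$ is the simple graph on vertices $1,\ldots,n$ where $\{i,j\}$ ($i\neq j$) is an edge if and only if $a_{ij}\neq 0$ (the diagonal entries are unrestricted). For a graph $G$ on $n$ vertices, $S(G)$ is the set of all $n\times n$ real symmetric matrices whose graph is $G$, and $M(G)$ is the maximum multiplicity of an eigenvalue of a matrix in $S(G)$; equivalently $M(G)=\max_{A\in S(G)}\operatorname{nullity}(A)$. Say that deletion of $q$ vertices from $G$ leaves $p$ vertex-disjoint paths if the remaining induced subgraph has exactly $p$ connected components, each of which is a path (a single vertex counts as a path). $\Delta(G)$ is the maximum of $p-q$, and $\Delta^+(G)$ is the minimum of $p+q$, over all ways of deleting $q$ vertices from $G$ leaving $p$ vertex-disjoint paths. The path cover number $P(G)$ is the minimum number of vertex-disjoint paths, each occurring as an induced subgraph of $G$, that cover all the vertices of $G$ (the graph with no vertices has path cover number $0$). For a set $S$ of vertices of $G$, $G\setminus S$ is the induced subgraph obtained by deleting $S$. Define $$T^-(G)=\max\{P(G\setminus S)-|S| : S\subseteq V(G),\ G\setminus S \text{ is a forest}\},$$ $$T^+(G)=\min\{P(G\setminus S)+|S| : S\subseteq V(G),\ G\setminus S \text{ is a forest}\}.$$ A zero forcing set of $G$ is a set $Z$ of vertices such that, if initially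 exactly the vertices of $Z$ are colored, then all vertices of $G$ become colored after repeatedly applying the rule: if $u$ is a colored vertex with exactly one uncolored neighbor $v$, then color $v$. The zero forcing number $Z(G)$ is the minimum size of a zero forcing set of $G$. *)

theory Defs
  imports
    "Graph_Theory.Graph_Theory"
    "Jordan_Normal_Form.Char_Poly"
    "HOL-Library.Disjoint_Sets"
begin

text \<open>
  A finite simple graph is a digraph satisfying the locale \<^locale>\<open>graph\<close>: finite, without loops
  and parallel arcs, and symmetric, so that an undirected edge is a pair of opposite arcs.
  For such graphs the strongly connected components are the usual connected components.
\<close>

abbreviation neighbors :: "('a,'b) pre_digraph \<Rightarrow> 'a \<Rightarrow> 'a set" where
  "neighbors G u \<equiv> {v. (u, v) \<in> arcs_ends G}"

definition delete_verts :: "('a,'b) pre_digraph \<Rightarrow> 'a set \<Rightarrow> ('a,'b) pre_digraph" where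
  "delete_verts G S = induce_subgraph G (verts G - S)"

definition path_graph :: "('a,'b) pre_digraph \<Rightarrow> bool" where
  "path_graph G \<longleftrightarrow>
     (\<exists>p. p \<noteq> [] \<and> distinct p \<and> verts G = set p \<and>
          arcs_ends G = set (vwalk_arcs p) \<union> (set (vwalk_arcs p))\<inverse>)"

text \<open>
  The library's \<^const>\<open>forest\<close> is not usable for symmetric digraphs: there, a pair of opposite arcs
  already is a cycle. A cycle of the undirected graph is a cycle with at least three arcs.
\<close>

definition undirected_forest :: "('a,'b) pre_digraph \<Rightarrow> bool" where
  "undirected_forest G \<longleftrightarrow> \<not> (\<exists>c. pre_digraph.cycle G c \<and> length c \<ge> 3)"


section \<open>Maximum multiplicity\<close>

text \<open>Vertices are numbered from 0, in accordance with the matrix indices.\<close>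

definition graph_of_mat :: "real mat \<Rightarrow> nat pair_pre_digraph" where
  "graph_of_mat A =
     \<lparr> pverts = {..<dim_row A},
       parcs = {(i, j). i < dim_row A \<and> j < dim_row A \<and> i \<noteq> j \<and> A $$ (i, j) \<noteq> 0} \<rparr>"

text \<open>
  The vertices of \<open>G\<close> need not be numbers, hence the graph of the matrix is compared with \<open>G\<close>
  up to isomorphism, that is, up to the choice of a numbering of the vertices of \<open>G\<close>.
\<close>

definition sym_mats :: "('a,'b) pre_digraph \<Rightarrow> real mat set" where
  "sym_mats G =
     {A \<in> carrier_mat (card (verts G)) (card (verts G)).
        transpose_mat A = A \<and> digraph_iso (with_proj (graph_of_mat A)) G}"

text \<open>
  The multiplicity of \<open>x\<close> is its order as a root of the characteristic polynomial. Letting \<open>x\<close> range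
  over all reals instead of the eigenvalues only adds zeros to the set; this
  matters only for the graph without vertices, whose maximum multiplicity becomes 0.
\<close>

definition max_mult :: "('a,'b) pre_digraph \<Rightarrow> nat" where
  "max_mult G = Max {Polynomial.order x (char_poly A) | A x. A \<in> sym_mats G}"


section \<open>Deleting vertices to leave paths\<close>

definition leaves_paths :: "('a,'b) pre_digraph \<Rightarrow> 'a set \<Rightarrow> nat \<Rightarrow> bool" where
  "leaves_paths G S p \<longleftrightarrow>
     card (pre_digraph.sccs (delete_verts G S)) = p \<and>
     (\<forall>H \<in> pre_digraph.sccs (delete_verts G S). path_graph H)"

definition Delta :: "('a,'b) pre_digraph \<Rightarrow> int" where
  "Delta G = Max {int p - int (card S) | S p. S \<subseteq> verts G \<and> leaves_paths G S p}"

definition Delta_plus :: "('a,'b) pre_digraph \<Rightarrow> nat" where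
  "Delta_plus G = Min {p + card S | S p. S \<subseteq> verts G \<and> leaves_paths G S p}"


section \<open>Path covers of forests obtained by deleting vertices\<close>

text \<open>
  An induced path is determined by its vertex set, so a set of vertex-disjoint induced paths
  covering all vertices is a partition of the vertex set into blocks that induce paths.
\<close>

definition path_cover :: "('a,'b) pre_digraph \<Rightarrow> 'a set set \<Rightarrow> bool" where
  "path_cover G Q \<longleftrightarrow> partition_on (verts G) Q \<and> (\<forall>W \<in> Q. path_graph (induce_subgraph G W))"

definition path_cover_number :: "('a,'b) pre_digraph \<Rightarrow> nat" where
  "path_cover_number G = Min {card Q | Q. path_cover G Q}"

definition T_minus :: "('a,'b) pre_digraph \<Rightarrow> int" where
  "T_minus G = Max {int (path_cover_number (delete_verts G S)) - int (card S) | S.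
     S \<subseteq> verts G \<and> undirected_forest (delete_verts G S)}"

definition T_plus :: "('a,'b) pre_digraph \<Rightarrow> nat" where
  "T_plus G = Min {path_cover_number (delete_verts G S) + card S | S.
     S \<subseteq> verts G \<and> undirected_forest (delete_verts G S)}"


section \<open>Zero forcing\<close>

text \<open>\<open>color_step G B B'\<close>: one application of the rule takes the colored set \<open>B\<close> to \<open>B'\<close>.\<close>

definition color_step :: "('a,'b) pre_digraph \<Rightarrow> 'a set \<Rightarrow> 'a set \<Rightarrow> bool" where
  "color_step G B B' \<longleftrightarrow> (\<exists>u \<in> B. \<exists>v. neighbors G u - B = {v} \<and> B' = insert v B)"

definition zero_forcing_set :: "('a,'b) pre_digraph \<Rightarrow> 'a set \<Rightarrow> bool" where
  "zero_forcing_set G Z \<longleftrightarrow> Z \<subseteq> verts G \<and> (color_step G)\<^sup>*\<^sup>* Z (verts G)"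

definition zero_forcing_number :: "('a,'b) pre_digraph \<Rightarrow> nat" where
  "zero_forcing_number G = Min {card Z | Z. zero_forcing_set G Z}"

end

theory Submission
  imports Defs "Jordan_Normal_Form.Schur_Decomposition"
begin

text \<open>
  The paths that remain after deleting \<open>S\<close> from \<open>G\<close> are the blocks of a partition of \<open>verts G - S\<close>
  into induced paths without edges between different blocks. So both \<open>Delta\<close> and \<open>Delta_plus\<close>
  optimise over such separated path partitions, and every one of them exhibits \<open>G - S\<close> as a
  forest whose path cover number is the number of blocks. This gives \<open>Delta \<le> T_minus\<close> and
  \<open>T_plus \<le> Delta_plus\<close>.

  For \<open>T_minus \<le> Delta\<close> a duality in forests is needed (\<open>forest_path_dual\<close>): a forest has a
  path cover \<open>R\<close> and a vertex set \<open>S\<close> whose deletion leaves at least \<open>card R + card S\<close> paths. It is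
  built by induction. A nonempty forest has either a component that is a path, or a vertex \<open>v\<close> to
  which two pendant paths are attached (\<open>pendant_paths\<close>). In the first case the component is added
  on both sides. In the second one \<open>v\<close> joins \<open>S\<close>, which leaves the two pendant paths as separate
  components, while the cover gets the single path running through \<open>v\<close>.

  For \<open>Delta \<le> max_mult\<close>, take the matrix with entry \<open>-1\<close> for every edge and with a diagonal that
  makes it a Laplacian on each of the \<open>p\<close> components of \<open>G - S\<close>. The indicator vectors of
  the components span a space of dimension \<open>p\<close> that is mapped to vectors supported on \<open>S\<close>, so \<open>0\<close> has
  multiplicity at least \<open>p - card S\<close>. The determinant version of this argument in
  \<open>order_char_poly_ge_blocks\<close> finds the power of the indeterminate directly in the Leibniz formula.

  For \<open>max_mult \<le> zero_forcing_number\<close>, an eigenvector of a matrix of \<open>G\<close> that vanishes on the colored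
  vertices also vanishes on the vertex colored next, hence an eigenvector that is zero on a zero
  forcing set is zero. As the matrix is symmetric, the multiplicity of an eigenvalue is the
  dimension of its eigenspace (\<open>order_char_poly_le_card\<close>).

  For \<open>zero_forcing_number \<le> T_plus\<close>, color \<open>S\<close> and one end of every path in a cover of the
  forest \<open>G - S\<close>. If no vertex could be forced although some are uncolored, then one could walk
  forever in the forest without turning back (\<open>path_heads_force\<close>).

  If \<open>G\<close> is itself a forest, then \<open>S = {}\<close> is admissible in both \<open>T_minus\<close> and \<open>T_plus\<close>, so that
  \<open>T_plus \<le> P(G) \<le> T_minus\<close> and the whole chain from \<open>T_minus\<close> to \<open>T_plus\<close> collapses.
\<close>

section \<open>Induced paths and forests in terms of the adjacency relation\<close>

text \<open>
  The combinatorial part only depends on the adjacency relation \<open>E\<close>. Stating it for relations and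
  vertex sets avoids passing to subgraphs: an induced subgraph is given by \<open>E\<close> and its vertex set.
\<close>

definition path_list :: "('a \<times> 'a) set \<Rightarrow> 'a list \<Rightarrow> bool" where
  "path_list E p \<longleftrightarrow> p \<noteq> [] \<and> distinct p \<and>
     E \<inter> set p \<times> set p = set (vwalk_arcs p) \<union> (set (vwalk_arcs p))\<inverse>"

definition induces_path :: "('a \<times> 'a) set \<Rightarrow> 'a set \<Rightarrow> bool" where
  "induces_path E W \<longleftrightarrow> (\<exists>p. path_list E p \<and> W = set p)"

text \<open>
  A finite graph is a forest iff it is 1-degenerate, that is, every nonempty induced subgraph has
  a vertex of degree at most one. In this form heredity is immediate, and the leaves that the
  inductions need are available directly.
\<close>

definition one_degenerate :: "('a \<times> 'a) set \<Rightarrow> 'a set \<Rightarrow> bool" where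
  "one_degenerate E X \<longleftrightarrow> (\<forall>W\<subseteq>X. W \<noteq> {} \<longrightarrow>
     (\<exists>x\<in>W. \<forall>y\<in>W. \<forall>z\<in>W. (x, y) \<in> E \<and> (x, z) \<in> E \<longrightarrow> y = z))"

definition separated :: "('a \<times> 'a) set \<Rightarrow> 'a set set \<Rightarrow> bool" where
  "separated E Q \<longleftrightarrow> (\<forall>C\<in>Q. \<forall>D\<in>Q. C \<noteq> D \<longrightarrow> E \<inter> C \<times> D = {})"

definition path_partition :: "('a \<times> 'a) set \<Rightarrow> 'a set \<Rightarrow> 'a set set \<Rightarrow> bool" where
  "path_partition E X Q \<longleftrightarrow> partition_on X Q \<and> (\<forall>C\<in>Q. induces_path E C)"

lemma in_vwalk_arcs_iff:
  "(a, b) \<in> set (vwalk_arcs p) \<longleftrightarrow> (\<exists>i. Suc i < length p \<and> a = p ! i \<and> b = p ! Suc i)"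
proof (induction p rule: vwalk_arcs.induct)
  case (3 x y xs)
  have "(\<exists>i. Suc i < length (x # y # xs) \<and> a = (x # y # xs) ! i \<and> b = (x # y # xs) ! Suc i) \<longleftrightarrow>
      (a = x \<and> b = y) \<or> (\<exists>i. Suc i < length (y # xs) \<and> a = (y # xs) ! i \<and> b = (y # xs) ! Suc i)"
    (is "(\<exists>i. ?P i) \<longleftrightarrow> _ \<or> (\<exists>i. ?Q i)")
  proof -
    have "(\<exists>i. ?P i) \<longleftrightarrow> ?P 0 \<or> (\<exists>i. ?P (Suc i))" by (metis not0_implies_Suc)
    then show ?thesis by simp
  qed
  then show ?case using 3 by simp
qed auto

lemma set_vwalk_arcs_rev: "set (vwalk_arcs (rev p)) = (set (vwalk_arcs p))\<inverse>"
proof (induction p rule: vwalk_arcs.induct)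
  case (3 x y xs)
  then show ?case using set_vwalk_arcs_snoc[of "rev (y # xs)" x] by (auto simp: last_rev)
qed auto

lemma vwalk_arcs_subset: "set (vwalk_arcs p) \<subseteq> set p \<times> set p"
  by (induction p rule: vwalk_arcs.induct) auto

lemma path_list_nonempty: "path_list E p \<Longrightarrow> p \<noteq> []"
  by (simp add: path_list_def)

lemma path_list_adjacent_iff:
  assumes "path_list E p" "i < length p" "j < length p"
  shows "(p ! i, p ! j) \<in> E \<longleftrightarrow> j = Suc i \<or> i = Suc j"
proof -
  have eq: "E \<inter> set p \<times> set p = set (vwalk_arcs p) \<union> (set (vwalk_arcs p))\<inverse>"
    and d: "distinct p" using assms(1) by (simp_all add: path_list_def)
  have "(p ! i, p ! j) \<in> E \<longleftrightarrow> (p ! i, p ! j) \<in> E \<inter> set p \<times> set p" using assms(2,3) by simp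
  also have "\<dots> \<longleftrightarrow> (p ! i, p ! j) \<in> set (vwalk_arcs p) \<or> (p ! j, p ! i) \<in> set (vwalk_arcs p)"
    unfolding eq by simp
  also have "\<dots> \<longleftrightarrow> j = Suc i \<or> i = Suc j"
    unfolding in_vwalk_arcs_iff using assms(2,3) d
    by (metis Suc_lessD nth_eq_iff_index_eq)
  finally show ?thesis .
qed

lemma path_list_singleton: "irrefl E \<Longrightarrow> path_list E [x]"
  by (auto simp: path_list_def irrefl_def)

lemma path_list_rev: "path_list E p \<Longrightarrow> path_list E (rev p)"
  by (auto simp: path_list_def set_vwalk_arcs_rev)

lemma path_list_append:
  assumes "sym E" "path_list E p" "path_list E q" "set p \<inter> set q = {}"
    and "E \<inter> set p \<times> set q = {(last p, hd q)}"
  shows "path_list E (p @ q)"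
proof -
  have ne: "p \<noteq> []" "q \<noteq> []" using assms by (auto simp: path_list_def)
  have "E \<inter> set q \<times> set p = (E \<inter> set p \<times> set q)\<inverse>" using assms(1) by (auto simp: sym_def)
  then have "E \<inter> set q \<times> set p = {(hd q, last p)}" using assms(5) by auto
  then have "E \<inter> set (p @ q) \<times> set (p @ q) =
      {(last p, hd q), (hd q, last p)} \<union> (E \<inter> set p \<times> set p) \<union> (E \<inter> set q \<times> set q)"
    using assms(5) unfolding set_append Sigma_Un_distrib1 by blast
  then show ?thesis
    using assms(2-4) ne unfolding path_list_def by (simp add: vwalk_arcs_append) blast
qed

lemma path_list_Cons_tail:
  assumes "path_list E (x # q)" "q \<noteq> []"
  shows "path_list E q"
proof -
  have "E \<inter> set q \<times> set q = (E \<inter> set (x # q) \<times> set (x # q)) \<inter> set q \<times> set q" by auto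
  also have "\<dots> = set (vwalk_arcs q) \<union> (set (vwalk_arcs q))\<inverse>"
    using assms vwalk_arcs_subset[of q] unfolding path_list_def by (cases q) auto
  finally show ?thesis using assms by (simp add: path_list_def)
qed

lemma partition_on_insert_block:
  assumes "partition_on (X - C) Q" "C \<subseteq> X" "C \<noteq> {}"
  shows "partition_on X (insert C Q)" "C \<notin> Q"
proof -
  show "partition_on X (insert C Q)"
    using assms by (subst partition_on_insert) (auto simp: disjnt_def dest: partition_onD1)
  show "C \<notin> Q" using assms by (auto dest!: partition_onD1)
qed

lemma one_degenerate_subset: "one_degenerate E X \<Longrightarrow> Y \<subseteq> X \<Longrightarrow> one_degenerate E Y"
  unfolding one_degenerate_def using subset_trans by metis

section \<open>A duality for path covers of forests\<close>

text \<open>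
  Regard the forest as a set \<open>W\<close> of roots, each carrying a path \<open>c x\<close> that starts at \<open>x\<close> and
  otherwise touches nothing outside of itself; all edges between different paths join two roots.
  Take a leaf \<open>x\<close> of \<open>W\<close>. Without a neighbor in \<open>W\<close> its path is a component. Otherwise let \<open>y\<close> be
  the neighbor: if \<open>c y\<close> is more than the root \<open>y\<close>, then \<open>c x\<close> and the rest of \<open>c y\<close> are two paths
  attached at \<open>y\<close>; if not, prepending \<open>y\<close> to \<open>c x\<close> removes the root \<open>x\<close>, so the search ends. It
  starts with all vertices as roots and with one-vertex paths.
\<close>

lemma pendant_paths:
  assumes E: "sym E" "irrefl E" and deg: "one_degenerate E X"
    and W: "finite W" "W \<noteq> {}" "W \<subseteq> X"
    and path: "\<And>x. x \<in> W \<Longrightarrow> path_list E (c x) \<and> hd (c x) = x"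
    and disj: "\<And>x y. x \<in> W \<Longrightarrow> y \<in> W \<Longrightarrow> x \<noteq> y \<Longrightarrow> set (c x) \<inter> set (c y) = {}"
    and cover: "(\<Union>x\<in>W. set (c x)) = X"
    and cross: "\<And>x y u v. x \<in> W \<Longrightarrow> y \<in> W \<Longrightarrow> x \<noteq> y \<Longrightarrow> u \<in> set (c x) \<Longrightarrow> v \<in> set (c y) \<Longrightarrow>
        (u, v) \<in> E \<Longrightarrow> u = x \<and> v = y"
  shows "(\<exists>p. path_list E p \<and> set p \<subseteq> X \<and> E \<inter> set p \<times> (X - set p) = {}) \<or>
     (\<exists>p q v. path_list E p \<and> path_list E q \<and> path_list E (rev p @ v # q) \<and>
        set p \<union> set q \<union> {v} \<subseteq> X \<and>
        E \<inter> set p \<times> (X - set p) \<subseteq> UNIV \<times> {v} \<and> E \<inter> set q \<times> (X - set q) \<subseteq> UNIV \<times> {v})"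
  using W path disj cover cross
proof (induction "card W" arbitrary: W c rule: less_induct)
  case less
  note path = less.prems(4) and disj = less.prems(5) and cover = less.prems(6) and cross = less.prems(7)
  have self: "x \<in> set (c x)" if "x \<in> W" for x
    using path[OF that] by (metis hd_in_set path_list_nonempty)
  obtain x where x: "x \<in> W" and uniq: "\<And>y z. y \<in> W \<Longrightarrow> z \<in> W \<Longrightarrow> (x, y) \<in> E \<Longrightarrow> (x, z) \<in> E \<Longrightarrow> y = z"
    using deg less.prems(2,3) unfolding one_degenerate_def by meson
  have px: "path_list E (c x)" "hd (c x) = x" using path[OF x] by auto
  have out: "u = x \<and> v \<in> W \<and> (x, v) \<in> E" if uv: "u \<in> set (c x)" "v \<in> X - set (c x)" "(u, v) \<in> E" for u v
  proof -
    have "v \<in> (\<Union>x\<in>W. set (c x))" using cover uv by simp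
    then obtain z where z: "z \<in> W" "v \<in> set (c z)" by blast
    then have "x \<noteq> z" using uv by auto
    then show ?thesis using cross[OF x z(1) _ uv(1) z(2) uv(3)] uv z by auto
  qed
  show ?case
  proof (cases "\<exists>y\<in>W. (x, y) \<in> E")
    case False
    then have "E \<inter> set (c x) \<times> (X - set (c x)) = {}" using out by auto
    moreover have "set (c x) \<subseteq> X" using cover x by auto
    ultimately show ?thesis using px(1) by blast
  next
    case True
    then obtain y where y: "y \<in> W" "(x, y) \<in> E" by auto
    then have xy: "x \<noteq> y" using E(2) by (auto simp: irrefl_def)
    have yx: "(y, x) \<in> E" using symD[OF E(1) y(2)] .
    have py: "path_list E (c y)" "hd (c y) = y" using path[OF y(1)] by auto
    have dxy: "set (c x) \<inter> set (c y) = {}" using disj x y xy by auto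
    have exy: "E \<inter> set (c y) \<times> set (c x) = {(y, x)}"
      using cross[OF y(1) x xy[symmetric]] yx self[OF x] self[OF y(1)] by auto
    have exy': "E \<inter> set (c x) \<times> set (c y) = {(x, y)}"
      using cross[OF x y(1) xy] y(2) self[OF x] self[OF y(1)] by auto
    show ?thesis
    proof (cases "tl (c y)")
      case Nil
      then have cy: "c y = [y]" using py by (metis hd_Cons_tl path_list_nonempty)
      define c' where "c' = c(y := y # c x)"
      have c'y: "c' y = y # c x" and c'z: "\<And>z. z \<noteq> y \<Longrightarrow> c' z = c z" by (auto simp: c'_def)
      \<comment> \<open>The path of \<open>x\<close> now hangs below \<open>y\<close>, and \<open>W - {x}\<close> is a smaller set of roots.\<close>
      have new: "path_list E (y # c x)"
        using path_list_append[OF E(1) py(1) px(1)] dxy exy px cy by auto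
      show ?thesis
      proof (rule less.hyps)
        show "card (W - {x}) < card W" using x less.prems(1) by (intro card_Diff1_less)
        show "finite (W - {x})" "W - {x} \<noteq> {}" "W - {x} \<subseteq> X" using less.prems(1-3) y(1) xy by auto
        show "path_list E (c' z) \<and> hd (c' z) = z" if "z \<in> W - {x}" for z
          using that path new by (cases "z = y") (auto simp: c'_def)
        show "set (c' z) \<inter> set (c' w) = {}" if "z \<in> W - {x}" "w \<in> W - {x}" "z \<noteq> w" for z w
          using that disj[of z w] disj[of x z] disj[of x w] x cy by (auto simp: c'_def)
        show "(\<Union>z\<in>W - {x}. set (c' z)) = X"
        proof -
          have "(\<Union>z\<in>W - {x}. set (c' z)) = (\<Union>z\<in>W. set (c z))"
          proof -
            have W: "W - {x} = insert y (W - {x, y})" "W = insert x (insert y (W - {x, y}))"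
              using x y(1) xy by auto
            have "(\<Union>z\<in>W - {x}. set (c' z)) = set (c' y) \<union> (\<Union>z\<in>W - {x, y}. set (c' z))"
              by (subst W(1)) simp
            also have "\<dots> = set (c x) \<union> set (c y) \<union> (\<Union>z\<in>W - {x, y}. set (c z))"
              using cy c'y by (auto simp: c'z)
            also have "\<dots> = (\<Union>z\<in>W. set (c z))"
              using arg_cong[where f = "\<lambda>V. \<Union>z\<in>V. set (c z)", OF W(2)] by auto
            finally show ?thesis .
          qed
          then show ?thesis using cover by simp
        qed
        show "u = z \<and> v = w" if zw: "z \<in> W - {x}" "w \<in> W - {x}" "z \<noteq> w"
          and uv: "u \<in> set (c' z)" "v \<in> set (c' w)" "(u, v) \<in> E" for z w u v
        proof -
          \<comment> \<open>As \<open>x\<close> has no other neighbor than \<open>y\<close> among the roots, its path meets no third path.\<close>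
          have no: False if ab: "a \<in> set (c x)" "b \<in> set (c t)" "(a, b) \<in> E \<or> (b, a) \<in> E"
            and t: "t \<in> W" "t \<noteq> x" "t \<noteq> y" for a b t
          proof -
            have "(a, b) \<in> E" using ab(3) symD[OF E(1)] by blast
            moreover from this have "a = x \<and> b = t"
              using cross[OF x t(1) t(2)[symmetric] ab(1,2)] by simp
            ultimately show False using uniq[OF t(1) y(1) _ y(2)] t(3) by simp
          qed
          consider "z = y" | "w = y" | "z \<noteq> y" "w \<noteq> y" by blast
          then show ?thesis
          proof cases
            case 1
            then have w: "w \<noteq> y" "w \<noteq> x" "w \<in> W" using zw by auto
            then have "v \<in> set (c w)" using uv c'z by simp
            moreover have "u \<in> set (c x) \<or> u = y" using uv 1 c'y by auto
            ultimately show ?thesis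
              using no[of u v w] w uv(3) 1 cross[OF y(1) w(3) w(1)[symmetric] self[OF y(1)], of v] by metis
          next
            case 2
            then have z: "z \<noteq> y" "z \<noteq> x" "z \<in> W" using zw by auto
            then have "u \<in> set (c z)" using uv c'z by simp
            moreover have "v \<in> set (c x) \<or> v = y" using uv 2 c'y by auto
            ultimately show ?thesis
              using no[of v u z] z uv(3) 2 cross[OF z(3) y(1) z(1) _ self[OF y(1)], of u] by metis
          next
            case 3
            then have "u \<in> set (c z)" "v \<in> set (c w)" using uv c'z by auto
            then show ?thesis using uv(3) zw cross[of z w u v] by simp
          qed
        qed
      qed
    next
      case (Cons a l)
      define q where "q = tl (c y)"
      have cy: "c y = y # q" "q \<noteq> []" using Cons py by (auto simp: q_def) (metis list.collapse list.sel(2) list.distinct(1))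
      have pq: "path_list E q" using path_list_Cons_tail py(1) cy by simp
      have yq: "y \<notin> set q" using py(1) cy by (simp add: path_list_def)
      have "path_list E (rev (c x) @ y # q)"
        using path_list_append[OF E(1) path_list_rev[OF px(1)] py(1)] dxy exy' px py cy path_list_nonempty[OF px(1)]
        by (simp add: last_rev)
      moreover have "set (c x) \<union> set q \<union> {y} \<subseteq> X" using cover x y cy by auto
      moreover have "E \<inter> set (c x) \<times> (X - set (c x)) \<subseteq> UNIV \<times> {y}"
        using out uniq[OF y(1) _ y(2)] by auto
      moreover have "E \<inter> set q \<times> (X - set q) \<subseteq> UNIV \<times> {y}"
      proof (rule subrelI)
        fix u v assume "(u, v) \<in> E \<inter> set q \<times> (X - set q)"
        then have uv: "(u, v) \<in> E" "u \<in> set q" "v \<in> X" "v \<notin> set q" by auto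
        have "v \<in> (\<Union>x\<in>W. set (c x))" using cover uv by simp
        then obtain z where z: "z \<in> W" "v \<in> set (c z)" by blast
        show "(u, v) \<in> UNIV \<times> {y}"
        proof (cases "z = y")
          case False
          then have "u = y" using cross[OF y(1) z(1), of u v] uv z cy by auto
          then show ?thesis using uv yq by simp
        qed (use z uv cy in auto)
      qed
      ultimately show ?thesis using px(1) pq by blast
    qed
  qed
qed

lemma separated_insert:
  assumes "separated E Q" "sym E" "\<And>D. D \<in> Q \<Longrightarrow> E \<inter> C \<times> D = {}"
  shows "separated E (insert C Q)"
  unfolding separated_def
proof (intro ballI impI)
  fix D D' assume D: "D \<in> insert C Q" "D' \<in> insert C Q" "D \<noteq> D'"
  have sw: "E \<inter> D \<times> C = {}" if "D \<in> Q" for D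
    using assms(2) assms(3)[OF that] by (auto dest: symD)
  show "E \<inter> D \<times> D' = {}"
  proof (cases "D = C \<or> D' = C")
    case True
    then show ?thesis using D assms(3) sw by (metis insertE)
  next
    case False
    then show ?thesis using D assms(1) by (simp add: separated_def)
  qed
qed

text \<open>
  Deleting \<open>S\<close> from any path cover of \<open>X\<close> adds at most \<open>card S\<close> paths, and the pieces have to
  cover the \<open>card Q\<close> components of \<open>X - S\<close>. So every cover has at least \<open>card Q - card S\<close> paths,
  and the last conjunct certifies that both \<open>R\<close> and \<open>S\<close> are optimal.
\<close>

definition path_dual :: "('a \<times> 'a) set \<Rightarrow> 'a set \<Rightarrow> 'a set \<Rightarrow> 'a set set \<Rightarrow> 'a set set \<Rightarrow> bool" where
  "path_dual E X S Q R \<longleftrightarrow> S \<subseteq> X \<and> path_partition E (X - S) Q \<and> separated E Q \<and>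
     path_partition E X R \<and> card R + card S \<le> card Q"

lemma path_dual_component:
  assumes E: "sym E" and fin: "finite X"
    and p: "path_list E p" "set p \<subseteq> X" "E \<inter> set p \<times> (X - set p) = {}"
    and dual: "path_dual E (X - set p) S Q R"
  shows "path_dual E X S (insert (set p) Q) (insert (set p) R)"
proof -
  have ne: "set p \<noteq> {}" and ip: "induces_path E (set p)"
    using p(1) by (auto simp: path_list_def induces_path_def)
  have S: "S \<subseteq> X - set p" and Q: "path_partition E (X - set p - S) Q" "separated E Q"
    and R: "path_partition E (X - set p) R" and card: "card R + card S \<le> card Q"
    using dual by (simp_all add: path_dual_def)
  have eq: "X - set p - S = X - S - set p" by blast
  have Q': "partition_on (X - S - set p) Q"
    using Q(1) unfolding eq by (simp add: path_partition_def)
  have R': "partition_on (X - set p) R" using R by (simp add: path_partition_def)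
  have QX: "D \<subseteq> X - set p" if "D \<in> Q" for D using partition_onD1[OF Q'] that by blast
  have pS: "set p \<subseteq> X - S" using S p(2) by blast
  note insQ = partition_on_insert_block[OF Q' pS ne]
  note insR = partition_on_insert_block[OF R' p(2) ne]
  have "path_partition E (X - S) (insert (set p) Q)" "path_partition E X (insert (set p) R)"
    using insQ(1) insR(1) Q(1) R ip by (simp_all add: path_partition_def)
  moreover have "separated E (insert (set p) Q)"
    using Q(2) E(1)
  proof (rule separated_insert)
    show "E \<inter> set p \<times> D = {}" if "D \<in> Q" for D
      using QX[OF that] p(3) by blast
  qed
  moreover have "finite Q" "finite R"
    using finite_elements[OF _ Q'] finite_elements[OF _ R'] fin by simp_all
  then have "card (insert (set p) R) + card S \<le> card (insert (set p) Q)"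
    using insQ(2) insR(2) card by simp
  moreover have "S \<subseteq> X" using S by blast
  ultimately show ?thesis by (simp add: path_dual_def)
qed

text \<open>
  Deleting \<open>v\<close> separates the two pendant paths from the rest, so the deletion side gains two paths
  for one deleted vertex. The cover side joins them through \<open>v\<close> into one path, and both
  differences grow by one.
\<close>

lemma path_dual_pendants:
  assumes E: "sym E" and fin: "finite X"
    and p: "path_list E p" "path_list E q" "path_list E (rev p @ v # q)"
    and B: "B = set p \<union> set q \<union> {v}" "B \<subseteq> X"
    and att: "E \<inter> set p \<times> (X - set p) \<subseteq> UNIV \<times> {v}" "E \<inter> set q \<times> (X - set q) \<subseteq> UNIV \<times> {v}"
    and dual: "path_dual E (X - B) S Q R"
  shows "path_dual E X (insert v S) (insert (set q) (insert (set p) Q)) (insert B R)"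
proof -
  have d: "set p \<inter> set q = {}" "v \<notin> set p" "v \<notin> set q"
    using p(3) by (auto simp: path_list_def)
  have ne: "set p \<noteq> {}" "set q \<noteq> {}" using p(1,2) by (auto simp: path_list_def)
  have "set (rev p @ v # q) = B" by (auto simp: B)
  then have ip: "induces_path E (set p)" "induces_path E (set q)" "induces_path E B"
    using p unfolding induces_path_def by blast+
  have S: "S \<subseteq> X - B" and Q: "path_partition E (X - B - S) Q" "separated E Q"
    and R: "path_partition E (X - B) R" and card: "card R + card S \<le> card Q"
    using dual by (simp_all add: path_dual_def)
  let ?S = "insert v S"
  have eq: "X - B - S = X - ?S - set q - set p" unfolding B(1) by blast
  have Q': "partition_on (X - ?S - set q - set p) Q"
    using Q(1) unfolding eq by (simp add: path_partition_def)
  have R': "partition_on (X - B) R" using R by (simp add: path_partition_def)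
  have QX: "D \<subseteq> X - B" if "D \<in> Q" for D using partition_onD1[OF Q'] that unfolding B by blast
  have "set p \<subseteq> X - ?S - set q" "set q \<subseteq> X - ?S" using B S d by auto
  note insQ1 = partition_on_insert_block[OF Q' this(1) ne(1)]
    and insQ = partition_on_insert_block[OF partition_on_insert_block(1)[OF Q' this(1) ne(1)] this(2) ne(2)]
  have "B \<noteq> {}" by (simp add: B)
  note insR = partition_on_insert_block[OF R' B(2) this]
  have "path_partition E (X - ?S) (insert (set q) (insert (set p) Q))"
    using insQ(1) Q(1) ip(1,2) by (simp add: path_partition_def)
  moreover have "path_partition E X (insert B R)"
    using insR(1) R ip(3) by (simp add: path_partition_def)
  moreover have "separated E (insert (set q) (insert (set p) Q))"
  proof (intro separated_insert Q E)
    show pD: "E \<inter> set p \<times> D = {}" if "D \<in> Q" for D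
      using QX[OF that] att(1) unfolding B(1) by blast
    show "E \<inter> set q \<times> D = {}" if "D \<in> insert (set p) Q" for D
    proof (cases "D = set p")
      case True
      have "set p \<subseteq> X - set q" using B d(1) by blast
      then show ?thesis using True att(2) d(2) by blast
    next
      case False
      then have "D \<in> Q" using that by simp
      then show ?thesis using QX[of D] att(2) unfolding B(1) by blast
    qed
  qed
  moreover have "card (insert B R) + card ?S \<le> card (insert (set q) (insert (set p) Q))"
  proof -
    have "finite Q" "finite R" "finite S"
      using finite_elements[OF _ Q'] finite_elements[OF _ R'] fin S finite_subset[of S X] by auto
    moreover have "v \<notin> S" using S B by blast
    ultimately show ?thesis using insQ1(2) insQ(2) insR(2) card by simp
  qed
  moreover have "?S \<subseteq> X" using S B by blast
  ultimately show ?thesis by (simp add: path_dual_def)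
qed

lemma forest_path_dual:
  assumes E: "sym E" "irrefl E" and "finite X" and "one_degenerate E X"
  shows "\<exists>S Q R. path_dual E X S Q R"
  using \<open>finite X\<close> \<open>one_degenerate E X\<close>
proof (induction "card X" arbitrary: X rule: less_induct)
  case less
  note fin = less.prems(1) and deg = less.prems(2)
  have IH: "\<exists>S Q R. path_dual E (X - C) S Q R" if C: "C \<subseteq> X" "C \<noteq> {}" for C
  proof (rule less.hyps)
    show "card (X - C) < card X" using C fin by (intro psubset_card_mono) auto
    show "finite (X - C)" using fin by simp
    show "one_degenerate E (X - C)" using deg by (rule one_degenerate_subset) simp
  qed
  show ?case
  proof (cases "X = {}")
    case True
    then have "path_dual E X {} {} {}"
      by (simp add: path_dual_def path_partition_def partition_on_empty separated_def)
    then show ?thesis by blast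
  next
    case False
    note pend = pendant_paths[OF E deg fin False subset_refl, of "\<lambda>x. [x]"]
    have "(\<exists>p. path_list E p \<and> set p \<subseteq> X \<and> E \<inter> set p \<times> (X - set p) = {}) \<or>
       (\<exists>p q v. path_list E p \<and> path_list E q \<and> path_list E (rev p @ v # q) \<and>
        set p \<union> set q \<union> {v} \<subseteq> X \<and>
        E \<inter> set p \<times> (X - set p) \<subseteq> UNIV \<times> {v} \<and> E \<inter> set q \<times> (X - set q) \<subseteq> UNIV \<times> {v})"
      by (rule pend) (simp_all add: path_list_singleton[OF E(2)])
    then show ?thesis
    proof (elim disjE exE conjE)
      fix p assume p: "path_list E p" "set p \<subseteq> X" "E \<inter> set p \<times> (X - set p) = {}"
      have "set p \<noteq> {}" using p(1) by (simp add: path_list_def)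
      with IH[OF p(2)] obtain S Q R where "path_dual E (X - set p) S Q R" by blast
      from path_dual_component[OF E(1) fin p this] show ?thesis by blast
    next
      fix p q v
      assume p: "path_list E p" "path_list E q" "path_list E (rev p @ v # q)"
        and B: "set p \<union> set q \<union> {v} \<subseteq> X"
        and att: "E \<inter> set p \<times> (X - set p) \<subseteq> UNIV \<times> {v}" "E \<inter> set q \<times> (X - set q) \<subseteq> UNIV \<times> {v}"
      obtain S Q R where "path_dual E (X - (set p \<union> set q \<union> {v})) S Q R"
        using IH[OF B] by blast
      from path_dual_pendants[OF E(1) fin p refl B att this] show ?thesis by blast
    qed
  qed
qed

lemma path_in_block:
  assumes Q: "partition_on X Q" "separated E Q" and p: "p \<noteq> []" "set p \<subseteq> X" "set (vwalk_arcs p) \<subseteq> E"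
  shows "\<exists>C\<in>Q. set p \<subseteq> C"
  using p
proof (induction p rule: vwalk_arcs.induct)
  case (2 x)
  then show ?case using partition_onD1[OF Q(1)] by auto
next
  case (3 x y xs)
  then obtain C where C: "C \<in> Q" "set (y # xs) \<subseteq> C" by auto
  obtain D where D: "D \<in> Q" "x \<in> D" using 3 partition_onD1[OF Q(1)] by auto
  have "(x, y) \<in> E \<inter> D \<times> C" using 3 C D by auto
  then have "D = C" using Q(2) C(1) D(1) unfolding separated_def by blast
  then show ?case using C D by auto
qed simp

text \<open>
  A path is connected and so lies in a single block of \<open>Q\<close>; every block needs a path of its own.
\<close>

lemma card_components_le_path_partition:
  assumes "finite X" "partition_on X Q" "separated E Q" "path_partition E X R"
  shows "card Q \<le> card R"
proof -
  have "\<exists>C\<in>Q. W \<subseteq> C" if W: "W \<in> R" for W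
  proof -
    obtain p where p: "path_list E p" "W = set p"
      using assms(4) W by (auto simp: path_partition_def induces_path_def)
    have "set p \<subseteq> X" using assms(4) W p(2) by (auto simp: path_partition_def partition_on_def)
    moreover have "set (vwalk_arcs p) \<subseteq> E" using p(1) unfolding path_list_def by blast
    ultimately show ?thesis using path_in_block[OF assms(2,3)] p path_list_nonempty by blast
  qed
  then obtain f where f: "\<And>W. W \<in> R \<Longrightarrow> f W \<in> Q \<and> W \<subseteq> f W" by metis
  have finR: "finite R" using assms(1,4) by (auto simp: path_partition_def intro: finite_elements)
  have "Q \<subseteq> f ` R"
  proof
    fix C assume C: "C \<in> Q"
    then have "C \<noteq> {}" "C \<subseteq> X" using assms(2) unfolding partition_on_def by auto
    then obtain x where x: "x \<in> C" "x \<in> X" by blast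
    then obtain W where W: "W \<in> R" "x \<in> W" using assms(4) unfolding path_partition_def partition_on_def by blast
    then have "x \<in> f W" "f W \<in> Q" using f by auto
    then have "f W = C" using C x assms(2) unfolding partition_on_def disjoint_def by blast
    then show "C \<in> f ` R" using W by blast
  qed
  then show ?thesis using finR by (meson card_image_le card_mono finite_imageI le_trans)
qed

text \<open>
  In a set \<open>W\<close> that meets the path \<open>C\<close>, the last vertex of \<open>C\<close> in \<open>W\<close> can only have its
  predecessor as a neighbor in \<open>W\<close>.
\<close>

lemma one_degenerate_separated_paths:
  assumes Q: "path_partition E X Q" "separated E Q"
  shows "one_degenerate E X"
  unfolding one_degenerate_def
proof (intro allI impI)
  fix W assume W: "W \<subseteq> X" "W \<noteq> {}"
  then obtain C where C: "C \<in> Q" "W \<inter> C \<noteq> {}" using Q(1) unfolding path_partition_def partition_on_def by blast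
  then obtain p where p: "path_list E p" "C = set p" using Q(1) by (auto simp: path_partition_def induces_path_def)
  define I where "I = {i. i < length p \<and> p ! i \<in> W}"
  have "I \<noteq> {}" "finite I" using C(2) p(2) by (auto simp: I_def in_set_conv_nth)
  define m where "m = Max I"
  have m: "m \<in> I" and max: "\<And>i. i \<in> I \<Longrightarrow> i \<le> m" using \<open>I \<noteq> {}\<close> \<open>finite I\<close> by (auto simp: m_def)
  have nbr: "m > 0 \<and> y = p ! (m - 1)" if y: "y \<in> W" "(p ! m, y) \<in> E" for y
  proof -
    obtain D where D: "D \<in> Q" "y \<in> D" using W y Q(1) unfolding path_partition_def partition_on_def by blast
    have "(p ! m, y) \<in> E \<inter> C \<times> D" using y D m p(2) by (auto simp: I_def)
    then have "D = C" using Q(2) C(1) D(1) unfolding separated_def by blast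
    then obtain i where i: "i < length p" "y = p ! i" using D p(2) by (auto simp: in_set_conv_nth)
    have "i \<in> I" using i y by (simp add: I_def)
    then have "i \<le> m" by (rule max)
    moreover have "i = Suc m \<or> m = Suc i" using path_list_adjacent_iff[OF p(1), of m i] i y m by (simp add: I_def)
    ultimately show ?thesis using i by auto
  qed
  show "\<exists>x\<in>W. \<forall>y\<in>W. \<forall>z\<in>W. (x, y) \<in> E \<and> (x, z) \<in> E \<longrightarrow> y = z"
    using nbr m by (intro bexI[of _ "p ! m"]) (auto simp: I_def)
qed

section \<open>Forcing from the ends of a path cover\<close>

text \<open>
  A walk that follows \<open>f\<close> and never turns back eventually runs around a cycle. In terms of leaves:
  on a minimal nonempty set \<open>W\<close> closed under \<open>f\<close> the map \<open>f\<close> is onto, so a leaf \<open>x\<close> of \<open>W\<close> has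
  both \<open>f x\<close> and a preimage as neighbors, and these must coincide.
\<close>

lemma one_degenerate_imp_backtrack:
  assumes "one_degenerate E X" "sym E" and H: "finite H" "H \<noteq> {}" "H \<subseteq> X"
    and f: "\<And>x. x \<in> H \<Longrightarrow> f x \<in> H" "\<And>x. x \<in> H \<Longrightarrow> (x, f x) \<in> E"
  shows "\<exists>x\<in>H. f (f x) = x"
proof -
  define \<W> where "\<W> = {W. W \<subseteq> H \<and> W \<noteq> {} \<and> f ` W \<subseteq> W}"
  have "finite \<W>" "\<W> \<noteq> {}" using H f(1) by (auto simp: \<W>_def intro!: exI[of _ H])
  then obtain W where W: "W \<in> \<W>" and min: "\<And>W'. W' \<in> \<W> \<Longrightarrow> W' \<subseteq> W \<Longrightarrow> W' = W"
    using finite_has_minimal by metis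
  have "f ` W \<in> \<W>" "f ` W \<subseteq> W" using W by (auto simp: \<W>_def)
  then have fW: "f ` W = W" by (rule min)
  have "W \<subseteq> X" "W \<noteq> {}" using W H by (auto simp: \<W>_def)
  then obtain x where x: "x \<in> W" and uniq: "\<And>y z. y \<in> W \<Longrightarrow> z \<in> W \<Longrightarrow> (x, y) \<in> E \<Longrightarrow> (x, z) \<in> E \<Longrightarrow> y = z"
    using assms(1) unfolding one_degenerate_def by meson
  obtain y where y: "y \<in> W" "x = f y" using x fW by blast
  have WH: "W \<subseteq> H" using W by (simp add: \<W>_def)
  have "(y, x) \<in> E" using f(2)[of y] y WH by auto
  then have "(x, y) \<in> E" by (rule symD[OF assms(2)])
  moreover have "(x, f x) \<in> E" "f x \<in> W" using f(2)[of x] x WH fW by auto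
  ultimately have "f x = y" using uniq y by blast
  then show ?thesis using y WH by auto
qed

text \<open>
  Suppose that no vertex of \<open>B\<close> can force. On every path \<open>C\<close> that is not entirely colored, let \<open>u
  C\<close> be the vertex just before the first uncolored one. Besides this next vertex, \<open>u C\<close> must have
  another uncolored neighbor \<open>y C\<close>. It lies on a different path, since \<open>C\<close> is induced and its
  vertex before \<open>u C\<close> is colored. Walking from \<open>u C\<close> to \<open>y C\<close>, then back along the path of \<open>y C\<close>
  to its vertex \<open>u\<close>, and so on, never turns back, which is impossible in a forest.
\<close>

lemma path_heads_force:
  assumes E: "sym E" and deg: "one_degenerate E X" and fin: "finite X"
    and R: "partition_on X R" and pl: "\<And>C. C \<in> R \<Longrightarrow> path_list E (pl C) \<and> set (pl C) = C"
    and B: "(\<lambda>C. hd (pl C)) ` R \<subseteq> B" "\<not> X \<subseteq> B"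
    and nbrs: "\<And>u. u \<in> X \<Longrightarrow> {v. (u, v) \<in> E} \<subseteq> X \<union> B"
  shows "\<exists>u\<in>B. \<exists>v. {v. (u, v) \<in> E} - B = {v}"
proof (rule ccontr)
  assume stuck: "\<not> ?thesis"
  have blk_unique: "C = D" if "C \<in> R" "D \<in> R" "x \<in> C" "x \<in> D" for C D x
    using R that unfolding partition_on_def disjoint_def by blast
  define R' where "R' = {C \<in> R. \<not> C \<subseteq> B}"
  define k where "k C = (LEAST i. i < length (pl C) \<and> pl C ! i \<notin> B)" for C
  have k: "k C < length (pl C) \<and> pl C ! k C \<notin> B" if C: "C \<in> R'" for C
  proof -
    have "\<exists>x\<in>set (pl C). x \<notin> B" using C pl by (auto simp: R'_def)
    then have "\<exists>i. i < length (pl C) \<and> pl C ! i \<notin> B" by (metis in_set_conv_nth)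
    then show ?thesis unfolding k_def by (rule LeastI_ex)
  qed
  have k_min: "pl C ! i \<in> B" if "i < k C" "C \<in> R'" for C i
    using not_less_Least[of i "\<lambda>i. i < length (pl C) \<and> pl C ! i \<notin> B"] that k[of C]
    unfolding k_def by auto
  have R'R: "C \<in> R" if "C \<in> R'" for C using that by (simp add: R'_def)
  have dist: "distinct (pl C)" "pl C \<noteq> []" "path_list E (pl C)" "set (pl C) = C" if "C \<in> R'" for C
    using pl[OF R'R[OF that]] by (auto simp: path_list_def)
  have k0: "k C > 0" if C: "C \<in> R'" for C
  proof (rule ccontr)
    assume "\<not> k C > 0"
    then have "hd (pl C) \<notin> B" using k[OF C] dist[OF C] by (simp add: hd_conv_nth)
    then show False using B(1) R'R[OF C] by auto
  qed
  define u where "u C = pl C ! (k C - 1)" for C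
  have "\<exists>y. (u C, y) \<in> E \<and> y \<notin> B \<and> y \<notin> C" if C: "C \<in> R'" for C
  proof -
    have len: "k C - 1 < length (pl C)" using conjunct1[OF k[OF C]] by linarith
    have uB: "u C \<in> B" using k_min[of "k C - 1" C] k0[OF C] C by (simp add: u_def)
    have "(u C, pl C ! k C) \<in> E"
      unfolding u_def using path_list_adjacent_iff[OF dist(3)[OF C] len, of "k C"] k[OF C] k0[OF C] by simp
    then have "pl C ! k C \<in> {v. (u C, v) \<in> E} - B" using k[OF C] by simp
    moreover have "{v. (u C, v) \<in> E} - B \<noteq> {pl C ! k C}" using stuck uB by blast
    ultimately obtain y where y: "(u C, y) \<in> E" "y \<notin> B" "y \<noteq> pl C ! k C" by blast
    have "y \<notin> C"
    proof
      assume "y \<in> C"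
      then obtain i where i: "i < length (pl C)" "y = pl C ! i"
        using dist(4)[OF C] by (metis in_set_conv_nth)
      then have "i = k C \<or> k C - 1 = Suc i"
        using path_list_adjacent_iff[OF dist(3)[OF C] len i(1)] y(1) k0[OF C] by (auto simp: u_def)
      then have "i < k C" using y(3) i(2) by auto
      then show False using k_min[OF _ C] i y(2) by auto
    qed
    then show ?thesis using y by blast
  qed
  then obtain y where y: "\<And>C. C \<in> R' \<Longrightarrow> (u C, y C) \<in> E \<and> y C \<notin> B \<and> y C \<notin> C" by metis
  \<comment> \<open>One step of the walk: along the path towards its colored end, or from \<open>u C\<close> across to \<open>y C\<close>.\<close>
  define f where "f x = (let C = (THE C. C \<in> R \<and> x \<in> C); i = (THE i. i < length (pl C) \<and> pl C ! i = x)
      in if i = k C - 1 then y C else pl C ! (i - 1))" for x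
  have f: "f (pl C ! i) = (if i = k C - 1 then y C else pl C ! (i - 1))"
    if C: "C \<in> R'" and i: "i < length (pl C)" for C i
  proof -
    have iC: "pl C ! i \<in> C" using i dist(4)[OF C] nth_mem by blast
    have "(THE D. D \<in> R \<and> pl C ! i \<in> D) = C"
      using R'R[OF C] iC blk_unique by (intro the_equality) auto
    moreover have "(THE j. j < length (pl C) \<and> pl C ! j = pl C ! i) = i"
      using i dist(1)[OF C] by (intro the_equality) (auto simp: nth_eq_iff_index_eq)
    ultimately show ?thesis by (simp add: f_def)
  qed
  \<comment> \<open>The walk never goes below \<open>u C\<close>, which has index \<open>k C - 1\<close>, on any path \<open>C\<close>.\<close>
  define H where "H = {pl C ! i | C i. C \<in> R' \<and> i < length (pl C) \<and> k C - 1 \<le> i}"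
  have RX: "C \<subseteq> X" if "C \<in> R" for C using partition_onD1[OF R] that by blast
  have HX: "H \<subseteq> X"
  proof
    fix x assume "x \<in> H"
    then obtain C i where C: "C \<in> R'" "i < length (pl C)" "x = pl C ! i" by (auto simp: H_def)
    then have "x \<in> C" using dist(4)[OF C(1)] nth_mem by blast
    then show "x \<in> X" using RX[OF R'R[OF C(1)]] by blast
  qed
  have yC: "\<exists>D j. D \<in> R' \<and> D \<noteq> C \<and> j < length (pl D) \<and> k D \<le> j \<and> y C = pl D ! j" if C: "C \<in> R'" for C
  proof -
    have "u C \<in> C" unfolding u_def
      using conjunct1[OF k[OF C]] dist(4)[OF C] by (metis less_imp_diff_less nth_mem)
    then have "u C \<in> X" using RX[OF R'R[OF C]] by blast
    then have "y C \<in> X" using nbrs y[OF C] by blast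
    then obtain D where D: "D \<in> R" "y C \<in> D" using partition_onD1[OF R] by blast
    then have D': "D \<in> R'" using y[OF C] by (auto simp: R'_def)
    then obtain j where j: "j < length (pl D)" "y C = pl D ! j" using D(2) dist(4) by (metis in_set_conv_nth)
    have "\<not> j < k D" using k_min[OF _ D'] j y[OF C] by auto
    then show ?thesis using D' D j y[OF C] by (metis not_less)
  qed
  have "R' \<noteq> {}"
  proof
    assume "R' = {}"
    then have "C \<subseteq> B" if "C \<in> R" for C using that by (auto simp: R'_def)
    then show False using B(2) partition_onD1[OF R] by blast
  qed
  have "\<exists>x\<in>H. f (f x) = x"
  proof (rule one_degenerate_imp_backtrack[OF deg E])
    show "finite H" using HX fin finite_subset by blast
    show "H \<noteq> {}"
    proof -
      obtain C where "C \<in> R'" using \<open>R' \<noteq> {}\<close> by blast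
      then have "pl C ! k C \<in> H" using k[of C] diff_le_self[of "k C" 1] unfolding H_def by blast
      then show ?thesis by blast
    qed
    show "H \<subseteq> X" by (rule HX)
    fix x assume "x \<in> H"
    then obtain C i where C: "C \<in> R'" "i < length (pl C)" "k C - 1 \<le> i" "x = pl C ! i" by (auto simp: H_def)
    show "f x \<in> H"
    proof (cases "i = k C - 1")
      case True
      then have fx: "f x = y C" using f[OF C(1,2)] C(4) by simp
      obtain D j where D: "D \<in> R'" "j < length (pl D)" "k D \<le> j" "y C = pl D ! j"
        using yC[OF C(1)] by blast
      moreover have "k D - 1 \<le> j" using D(3) by simp
      ultimately show ?thesis unfolding fx H_def by blast
    next
      case False
      then have "f x = pl C ! (i - 1)" using f[OF C(1,2)] C(4) by simp
      moreover have "i - 1 < length (pl C)" "k C - 1 \<le> i - 1" using False C by auto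
      ultimately show ?thesis using C(1) unfolding H_def by blast
    qed
    show "(x, f x) \<in> E"
    proof (cases "i = k C - 1")
      case True
      then have "f x = y C" using f[OF C(1,2)] C(4) by simp
      then show ?thesis using y[OF C(1)] C True by (simp add: u_def)
    next
      case False
      then have "f x = pl C ! (i - 1)" using f[OF C(1,2)] C(4) by simp
      moreover have "i = Suc (i - 1)" using False C by auto
      ultimately show ?thesis using path_list_adjacent_iff[OF dist(3)[OF C(1)] C(2), of "i - 1"] C by auto
    qed
  qed
  then obtain x where x: "x \<in> H" "f (f x) = x" by blast
  then obtain C i where C: "C \<in> R'" "i < length (pl C)" "k C - 1 \<le> i" "x = pl C ! i" by (auto simp: H_def)
  have xC: "x \<in> C" using C dist(4)[OF C(1)] nth_mem by blast
  show False
  proof (cases "i = k C - 1")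
    case True
    then have fx: "f x = y C" using f[OF C(1,2)] C(4) by simp
    obtain D j where D: "D \<in> R'" "D \<noteq> C" "j < length (pl D)" "k D \<le> j" "y C = pl D ! j"
      using yC[OF C(1)] by blast
    have "j \<noteq> k D - 1" using D(4) k0[OF D(1)] by linarith
    then have "f (f x) = pl D ! (j - 1)" using f[OF D(1,3)] D(5) fx by simp
    then have "x \<in> D" using x(2) D(3) dist(4)[OF D(1)] nth_mem[of "j - 1" "pl D"] by simp
    then show False using blk_unique xC R'R C(1) D(1,2) by blast
  next
    case False
    then have fx: "f x = pl C ! (i - 1)" using f[OF C(1,2)] C(4) by simp
    have i1: "i - 1 < length (pl C)" using C(2) by simp
    show False
    proof (cases "i - 1 = k C - 1")
      case True
      then have "f (f x) = y C" using f[OF C(1) i1] fx by simp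
      then show False using x(2) y[OF C(1)] xC by simp
    next
      case False
      then have "pl C ! (i - 1 - 1) = pl C ! i" using f[OF C(1) i1] fx x(2) C(4) by simp
      then have "i - 1 - 1 = i" using dist(1)[OF C(1)] C(2) by (simp add: nth_eq_iff_index_eq)
      then show False using False C(3) by simp
    qed
  qed
qed

section \<open>Forests and cycles\<close>

lemma (in wf_digraph) walk_along_vertices:
  assumes "p \<noteq> []" "set p \<subseteq> verts G" "set (vwalk_arcs p) \<subseteq> arcs_ends G"
  shows "\<exists>es. awalk (hd p) es (last p) \<and> awalk_verts (hd p) es = p"
  using assms
proof (induction p rule: vwalk_arcs.induct)
  case (2 x)
  then show ?case by (intro exI[of _ "[]"]) (simp add: awalk_Nil_iff)
next
  case (3 x y xs)
  then obtain es where es: "awalk y es (last (y # xs))" "awalk_verts y es = y # xs" by auto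
  obtain e where e: "e \<in> arcs G" "tail G e = x" "head G e = y"
    using 3 by (auto simp: arcs_ends_conv)
  have "awalk x (e # es) (last (y # xs))" using es e by (simp add: awalk_Cons_iff)
  moreover have "awalk_verts x (e # es) = x # y # xs" using es e by simp
  ultimately show ?case by (intro exI[of _ "e # es"]) simp
qed simp

lemma (in wf_digraph) cas_nth_tail:
  "cas u p v \<Longrightarrow> i < length p \<Longrightarrow> tail G (p ! i) = (if i = 0 then u else head G (p ! (i - 1)))"
  by (induction p arbitrary: u i) (auto simp: nth_Cons' split: if_splits)

text \<open>
  All neighbors in \<open>W\<close> of an end of a longest path in \<open>W\<close> lie on the path. One of at least two
  such neighbors is not next to the end on the path, and closes a cycle of length at least three.
\<close>

lemma (in graph) min_degree_two_imp_cycle: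
  assumes W: "W \<noteq> {}" "W \<subseteq> verts G"
    and deg: "\<And>x. x \<in> W \<Longrightarrow> \<exists>y\<in>W. \<exists>z\<in>W. (x, y) \<in> arcs_ends G \<and> (x, z) \<in> arcs_ends G \<and> y \<noteq> z"
  shows "\<exists>c. cycle c \<and> length c \<ge> 3"
proof -
  define \<P> where "\<P> = {p. p \<noteq> [] \<and> distinct p \<and> set p \<subseteq> W \<and> set (vwalk_arcs p) \<subseteq> arcs_ends G}"
  have finW: "finite W" using W(2) finite_verts finite_subset by blast
  have "length p \<le> card W" if "p \<in> \<P>" for p
    using that finW by (auto simp: \<P>_def distinct_card[symmetric] intro: card_mono)
  then have bound: "\<forall>p. p \<in> \<P> \<longrightarrow> length p < Suc (card W)" by (simp add: less_Suc_eq_le)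
  obtain x0 where "x0 \<in> W" using W by blast
  then have "[x0] \<in> \<P>" by (simp add: \<P>_def)
  from ex_has_greatest_nat[of "\<lambda>p. p \<in> \<P>", OF this bound]
  obtain p where p: "p \<in> \<P>" and max: "\<And>q. q \<in> \<P> \<Longrightarrow> length q \<le> length p" by blast
  have pne: "p \<noteq> []" and pd: "distinct p" and pW: "set p \<subseteq> W" and pE: "set (vwalk_arcs p) \<subseteq> arcs_ends G"
    using p by (auto simp: \<P>_def)
  have sym: "(b, a) \<in> arcs_ends G" if "(a, b) \<in> arcs_ends G" for a b
    using that arcs_ends_symmetric[OF sym_arcs] by blast
  have nbr: "y \<in> set p" if y: "y \<in> W" "(hd p, y) \<in> arcs_ends G" for y
  proof (rule ccontr)
    assume "y \<notin> set p"
    then have "y # p \<in> \<P>" using pne pd pW pE y sym by (auto simp: \<P>_def)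
    then show False using max[of "y # p"] by simp
  qed
  have "hd p \<in> W" using pne pW by auto
  then obtain y z where yz: "y \<in> W" "z \<in> W" "(hd p, y) \<in> arcs_ends G" "(hd p, z) \<in> arcs_ends G" "y \<noteq> z"
    using deg by blast
  obtain i j where ij: "i < length p" "y = p ! i" "j < length p" "z = p ! j"
    using nbr yz by (metis in_set_conv_nth)
  have hd: "hd p = p ! 0" using pne by (simp add: hd_conv_nth)
  have irr: "(a, a) \<notin> arcs_ends G" for a using no_loops by (auto simp: arcs_ends_conv)
  have "i \<noteq> 0" "j \<noteq> 0" using yz(3,4) ij hd irr by metis+
  then have "i \<ge> 2 \<or> j \<ge> 2" using yz(5) ij by (metis One_nat_def Suc_1 not_less_eq_eq le_antisym not_less_eq_eq le_0_eq)
  then obtain k where k: "k \<ge> 2" "k < length p" "(hd p, p ! k) \<in> arcs_ends G" using ij yz by auto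
  define t where "t = take (Suc k) p"
  have t: "t \<noteq> []" "hd t = hd p" "distinct t" "length t = Suc k"
    using pne pd k by (simp_all add: t_def)
  have tl: "last t = p ! k" using t(1,4) k by (simp add: last_conv_nth t_def)
  have tv: "set t \<subseteq> verts G" using set_take_subset[of "Suc k" p] pW W(2) unfolding t_def by blast
  have "set (vwalk_arcs t) \<subseteq> set (vwalk_arcs (t @ drop (Suc k) p))" by (rule set_vwalk_arcs_append1)
  then have "set (vwalk_arcs t) \<subseteq> arcs_ends G" using pE by (simp add: t_def)
  then have "set (vwalk_arcs (t @ [hd p])) \<subseteq> arcs_ends G"
    using t tl sym k(3) by (simp add: set_vwalk_arcs_snoc)
  moreover have "set (t @ [hd p]) \<subseteq> verts G" using tv \<open>hd p \<in> W\<close> W(2) by auto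
  ultimately obtain es where es: "awalk (hd (t @ [hd p])) es (last (t @ [hd p]))"
      "awalk_verts (hd (t @ [hd p])) es = t @ [hd p]"
    using walk_along_vertices[of "t @ [hd p]"] by blast
  then have "awalk (hd p) es (hd p)" "awalk_verts (hd p) es = t @ [hd p]" using t by auto
  moreover have "distinct (tl (t @ [hd p]))"
    using t(1,2,3) by (cases t) auto
  moreover have len: "length es = Suc k"
    using arg_cong[OF es(2), of length] t by (simp add: length_awalk_verts)
  ultimately have "cycle es" unfolding cycle_def by (intro exI[of _ "hd p"]) auto
  then show ?thesis using len k by (intro exI[of _ es]) auto
qed

lemma (in graph) undirected_forest_imp_one_degenerate:
  assumes "undirected_forest G"
  shows "one_degenerate (arcs_ends G) (verts G)"
  using min_degree_two_imp_cycle assms unfolding one_degenerate_def undirected_forest_def by metis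

text \<open>
  On a cycle with at least three arcs, the predecessor and the successor of a vertex are
  different, so the vertices of the cycle span a subgraph without leaves.
\<close>

lemma (in graph) one_degenerate_imp_undirected_forest:
  assumes deg: "one_degenerate (arcs_ends G) (verts G)"
  shows "undirected_forest G"
  unfolding undirected_forest_def
proof
  assume "\<exists>c. cycle c \<and> length c \<ge> 3"
  then obtain c u where c: "awalk u c u" "distinct (tl (awalk_verts u c))" "length c \<ge> 3"
    by (auto simp: cycle_def)
  have cas: "cas u c u" and arcs: "set c \<subseteq> arcs G" using c by auto
  define t where "t = map (head G) c"
  let ?n = "length c"
  have t: "distinct t" using c(2,3) awalk_verts_conv'[OF cas] by (auto simp: t_def split: if_splits)
  have "c \<noteq> []" using c(3) by auto
  then have last: "last t = u" using awlast_if_cas[OF cas] awalk_verts_conv'[OF cas] by (simp add: t_def)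
  have lt: "length t = ?n" by (simp add: t_def)
  have step: "(t ! (if i = 0 then ?n - 1 else i - 1), t ! i) \<in> arcs_ends G" if i: "i < ?n" for i
  proof -
    have "c ! i \<in> arcs G" using arcs i nth_mem by blast
    then have "(tail G (c ! i), head G (c ! i)) \<in> arcs_ends G" by (rule in_arcs_imp_in_arcs_ends)
    moreover have "tail G (c ! i) = t ! (if i = 0 then ?n - 1 else i - 1)"
    proof (cases "i = 0")
      case True
      have "t \<noteq> []" using c(3) by (auto simp: t_def)
      then have "t ! (?n - 1) = u" using last lt by (simp add: last_conv_nth)
      then show ?thesis using cas_nth_tail[OF cas i] True by simp
    next
      case False
      then show ?thesis using cas_nth_tail[OF cas i] i by (auto simp: t_def)
    qed
    ultimately show ?thesis using i by (simp add: t_def)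
  qed
  have sym: "(b, a) \<in> arcs_ends G" if "(a, b) \<in> arcs_ends G" for a b
    using that arcs_ends_symmetric[OF sym_arcs] by blast
  have "set t \<subseteq> verts G" using arcs by (auto simp: t_def)
  moreover have "set t \<noteq> {}" using c(3) by (auto simp: t_def)
  ultimately obtain x where x: "x \<in> set t"
    and uniq: "\<And>y z. y \<in> set t \<Longrightarrow> z \<in> set t \<Longrightarrow> (x, y) \<in> arcs_ends G \<Longrightarrow> (x, z) \<in> arcs_ends G \<Longrightarrow> y = z"
    using deg unfolding one_degenerate_def by meson
  obtain i where i: "i < ?n" "x = t ! i" using x lt by (metis in_set_conv_nth)
  define a where "a = (if i = 0 then ?n - 1 else i - 1)"
  define b where "b = (if i = ?n - 1 then 0 else Suc i)"
  have ab: "a < ?n" "b < ?n" "a \<noteq> b" using i(1) c(3) by (auto simp: a_def b_def)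
  have "(x, t ! a) \<in> arcs_ends G" using sym[OF step[OF i(1)]] i by (simp add: a_def)
  moreover have "(x, t ! b) \<in> arcs_ends G" using step[OF ab(2)] i by (auto simp: b_def split: if_splits)
  ultimately have "t ! a = t ! b" using uniq ab lt by simp
  then show False using t ab lt by (simp add: nth_eq_iff_index_eq)
qed

lemma arcs_ends_induce_subgraph:
  "arcs_ends (induce_subgraph G X) = arcs_ends G \<inter> X \<times> X"
  by (auto simp: arcs_ends_conv)

lemma path_graph_induce_iff: "path_graph (induce_subgraph G X) \<longleftrightarrow> induces_path (arcs_ends G) X"
  unfolding path_graph_def induces_path_def path_list_def arcs_ends_induce_subgraph by auto

lemma one_degenerate_restrict: "one_degenerate (E \<inter> X \<times> X) X \<longleftrightarrow> one_degenerate E X"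
  unfolding one_degenerate_def by (intro iff_allI imp_cong refl bex_cong ball_cong) auto

lemma induces_path_restrict:
  assumes "C \<subseteq> X"
  shows "induces_path (E \<inter> X \<times> X) C \<longleftrightarrow> induces_path E C"
proof -
  have "path_list (E \<inter> X \<times> X) p \<longleftrightarrow> path_list E p" if "C = set p" for p
  proof -
    have "E \<inter> X \<times> X \<inter> set p \<times> set p = E \<inter> set p \<times> set p" using assms that by blast
    then show ?thesis by (simp add: path_list_def)
  qed
  then show ?thesis unfolding induces_path_def by blast
qed

section \<open>Components and path covers after deleting vertices\<close>

context graph
begin

lemma sym_arcs_ends: "sym (arcs_ends G)"
  using sym_arcs by (simp add: symmetric_def)

lemma irrefl_arcs_ends: "irrefl (arcs_ends G)"
  using no_loops by (auto simp: irrefl_def arcs_ends_conv)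

lemma arcs_ends_subset: "arcs_ends G \<subseteq> verts G \<times> verts G"
  by (auto simp: arcs_ends_conv)

lemma graph_delete_verts: "graph (delete_verts G S)"
proof -
  have "induced_subgraph (delete_verts G S) G" unfolding delete_verts_def by (rule induced_induce) simp
  then have "digraph (delete_verts G S)" "symmetric (delete_verts G S)"
    by (rule digraphI_induced, rule induced_graph_imp_symmetric[OF sym_arcs])
  then show ?thesis
    by (simp add: graph_def pseudo_graph_def sym_digraph_def sym_digraph_axioms_def digraph_def fin_digraph_def)
qed

lemma undirected_forest_delete_verts_iff:
  "undirected_forest (delete_verts G S) \<longleftrightarrow> one_degenerate (arcs_ends G) (verts G - S)"
proof -
  interpret H: graph "delete_verts G S" by (rule graph_delete_verts)
  have "undirected_forest (delete_verts G S) \<longleftrightarrow>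
      one_degenerate (arcs_ends (delete_verts G S)) (verts (delete_verts G S))"
    using H.undirected_forest_imp_one_degenerate H.one_degenerate_imp_undirected_forest by blast
  then show ?thesis
    by (simp add: delete_verts_def arcs_ends_induce_subgraph one_degenerate_restrict)
qed

lemma path_cover_delete_verts_iff:
  "path_cover (delete_verts G S) Q \<longleftrightarrow> path_partition (arcs_ends G) (verts G - S) Q"
proof -
  have "path_graph (induce_subgraph (delete_verts G S) W) \<longleftrightarrow> induces_path (arcs_ends G) W"
    if "W \<in> Q" "partition_on (verts G - S) Q" for W
  proof -
    have "W \<subseteq> verts G - S" using that by (auto simp: partition_on_def)
    then show ?thesis
      by (simp add: path_graph_induce_iff delete_verts_def arcs_ends_induce_subgraph induces_path_restrict)
  qed
  then show ?thesis unfolding path_cover_def path_partition_def by (auto simp: delete_verts_def)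
qed

lemma ex_path_cover_number:
  "\<exists>R. path_partition (arcs_ends G) (verts G - S) R \<and> path_cover_number (delete_verts G S) = card R"
  and path_cover_number_le:
  "path_partition (arcs_ends G) (verts G - S) R \<Longrightarrow> path_cover_number (delete_verts G S) \<le> card R"
proof -
  let ?P = "{card Q | Q. path_cover (delete_verts G S) Q}"
  have "?P \<subseteq> card ` Pow (Pow (verts G))"
    by (auto simp: path_cover_delete_verts_iff path_partition_def partition_on_def)
  then have fin: "finite ?P" by (rule finite_subset) simp
  have "induces_path (arcs_ends G) {x}" for x
    using path_list_singleton[OF irrefl_arcs_ends] unfolding induces_path_def by (metis list.set(1) list.set(2))
  then have "path_cover (delete_verts G S) ((\<lambda>x. {x}) ` (verts G - S))"
    using partition_on_singletons by (auto simp: path_cover_delete_verts_iff path_partition_def)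
  then have "?P \<noteq> {}" by blast
  from Min_in[OF fin this] show "\<exists>R. path_partition (arcs_ends G) (verts G - S) R \<and>
      path_cover_number (delete_verts G S) = card R"
    by (auto simp: path_cover_number_def path_cover_delete_verts_iff)
  show "path_cover_number (delete_verts G S) \<le> card R" if "path_partition (arcs_ends G) (verts G - S) R"
    using Min_le[OF fin] that by (auto simp: path_cover_number_def path_cover_delete_verts_iff)
qed

lemma partition_on_sccs_verts: "partition_on (verts G) sccs_verts"
proof (rule partition_onI)
  show "\<Union>sccs_verts = verts G"
    using sccs_verts_subsets scc_of_in_sccs_verts in_scc_of_self by blast
  show "disjnt C D" if "C \<in> sccs_verts" "D \<in> sccs_verts" "C \<noteq> D" for C D
    using sccs_verts_disjoint[OF that] by (simp add: disjnt_def)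
qed (simp add: sccs_verts_def)

lemma separated_sccs_verts: "separated (arcs_ends G) sccs_verts"
  unfolding separated_def
proof (intro ballI impI)
  fix C D assume CD: "C \<in> sccs_verts" "D \<in> sccs_verts" "C \<noteq> D"
  then have "C \<inter> D = {}" by (rule sccs_verts_disjoint)
  moreover have "u \<rightarrow>\<^sup>* v \<and> v \<rightarrow>\<^sup>* u" if "(u, v) \<in> arcs_ends G" for u v
    using that symD[OF sym_arcs_ends] by (auto intro: reachable_adjI)
  ultimately show "arcs_ends G \<inter> C \<times> D = {}"
    using CD(1) unfolding in_sccs_verts_conv_reachable by blast
qed

lemma path_list_reachable:
  assumes "set p \<subseteq> verts G" "set (vwalk_arcs p) \<subseteq> arcs_ends G" "x \<in> set p"
  shows "hd p \<rightarrow>\<^sup>* x"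
  using assms
proof (induction p rule: vwalk_arcs.induct)
  case (3 a b xs)
  show ?case
  proof (cases "x = a")
    case False
    have "a \<rightarrow>\<^sup>* b" using 3 by (auto intro: reachable_adjI)
    moreover have "b \<rightarrow>\<^sup>* x" using 3 False by auto
    ultimately show ?thesis using reachable_trans[of a b x] by simp
  qed (use 3 in auto)
qed auto

text \<open>
  Paths are connected, and no walk leaves a block of a separated partition; hence the blocks are
  the components.
\<close>

lemma sccs_verts_eq_separated_paths:
  assumes Q: "path_partition (arcs_ends G) (verts G) Q" "separated (arcs_ends G) Q"
  shows "sccs_verts = Q"
proof -
  have part: "partition_on (verts G) Q" using Q(1) by (simp add: path_partition_def)
  have stay: "v \<in> C" if "u \<rightarrow>\<^sup>* v" "u \<in> C" "C \<in> Q" for u v C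
    using that(1,2)
  proof (induction rule: reachable_induct)
    case (step x y)
    then have "y \<in> verts G" by auto
    then obtain D where D: "D \<in> Q" "y \<in> D" using part by (auto simp: partition_on_def)
    then have "(x, y) \<in> arcs_ends G \<inter> C \<times> D" using step by auto
    then have "C = D" using Q(2) that(3) D(1) unfolding separated_def by blast
    then show ?case using D by simp
  qed
  have sub: "Q \<subseteq> sccs_verts"
  proof
    fix C assume C: "C \<in> Q"
    then obtain p where p: "path_list (arcs_ends G) p" "C = set p"
      using Q(1) by (auto simp: path_partition_def induces_path_def)
    have pV: "set p \<subseteq> verts G" using part C p(2) by (auto simp: partition_on_def)
    have "set (vwalk_arcs p) \<subseteq> arcs_ends G" using p(1) unfolding path_list_def by blast
    then have "hd p \<rightarrow>\<^sup>* x" if "x \<in> C" for x using path_list_reachable[OF pV] that p(2) by blast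
    then have "x \<rightarrow>\<^sup>* y" if "x \<in> C" "y \<in> C" for x y
      using that symmetric_reachable'[of "hd p" x] reachable_trans by blast
    moreover have "C \<noteq> {}" using p path_list_nonempty by auto
    ultimately show "C \<in> sccs_verts" unfolding in_sccs_verts_conv_reachable using stay C by blast
  qed
  have "D \<in> Q" if D: "D \<in> sccs_verts" for D
  proof -
    obtain x where x: "x \<in> D" "x \<in> verts G" using D sccs_verts_subsets[OF D] by (auto simp: sccs_verts_def)
    then obtain C where C: "C \<in> Q" "x \<in> C" using part by (auto simp: partition_on_def)
    then have "C = D" using sccs_verts_disjoint[of C D] sub D x by blast
    then show ?thesis using C by simp
  qed
  then show ?thesis using sub by blast
qed

end

lemma (in graph) leaves_paths_iff:
  "leaves_paths G S p \<longleftrightarrow> (\<exists>Q. path_partition (arcs_ends G) (verts G - S) Q \<and>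
     separated (arcs_ends G) Q \<and> card Q = p)"
proof -
  let ?H = "delete_verts G S" and ?E = "arcs_ends G" and ?X = "verts G - S"
  interpret H: graph ?H by (rule graph_delete_verts)
  have EH: "arcs_ends ?H = ?E \<inter> ?X \<times> ?X" and VH: "verts ?H = ?X"
    by (simp_all add: delete_verts_def arcs_ends_induce_subgraph)
  have pp: "path_partition (arcs_ends ?H) ?X Q \<longleftrightarrow> path_partition ?E ?X Q" for Q
    unfolding path_partition_def EH using induces_path_restrict by (metis Union_upper partition_onD1)
  have sep: "separated (arcs_ends ?H) Q \<longleftrightarrow> separated ?E Q" if Q: "partition_on ?X Q" for Q
  proof -
    have "?E \<inter> ?X \<times> ?X \<inter> C \<times> D = ?E \<inter> C \<times> D" if "C \<in> Q" "D \<in> Q" for C D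
      using Q that unfolding partition_on_def by blast
    then show ?thesis unfolding separated_def EH by simp
  qed
  have lp: "leaves_paths G S p \<longleftrightarrow> card H.sccs_verts = p \<and> (\<forall>C\<in>H.sccs_verts. induces_path (arcs_ends ?H) C)"
    unfolding leaves_paths_def H.card_sccs_verts H.sccs_conv_sccs_verts by (simp add: path_graph_induce_iff)
  show ?thesis
  proof
    assume "leaves_paths G S p"
    then have "card H.sccs_verts = p" "path_partition (arcs_ends ?H) ?X H.sccs_verts"
      using H.partition_on_sccs_verts unfolding lp path_partition_def VH by auto
    then show "\<exists>Q. path_partition ?E ?X Q \<and> separated ?E Q \<and> card Q = p"
      using pp sep H.separated_sccs_verts by (metis path_partition_def)
  next
    assume "\<exists>Q. path_partition ?E ?X Q \<and> separated ?E Q \<and> card Q = p"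
    then obtain Q where Q: "path_partition ?E ?X Q" "separated ?E Q" "card Q = p" by blast
    have "path_partition (arcs_ends ?H) (verts ?H) Q" using Q(1) pp VH by simp
    moreover have "separated (arcs_ends ?H) Q" using Q(1,2) sep by (simp add: path_partition_def)
    ultimately show "leaves_paths G S p"
      using H.sccs_verts_eq_separated_paths[of Q] Q(3) unfolding lp by (simp add: path_partition_def)
  qed
qed

section \<open>Multiplicities of eigenvalues\<close>

lemma underdetermined_system:
  fixes rs :: "'a::field vec list"
  assumes "set rs \<subseteq> carrier_vec n" "length rs < n"
  shows "\<exists>c\<in>carrier_vec n. c \<noteq> 0\<^sub>v n \<and> (\<forall>r\<in>set rs. r \<bullet> c = 0)"
proof -
  define M where "M = mat_of_rows n (rs @ replicate (n - length rs) (0\<^sub>v n))"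
  have M: "M \<in> carrier_mat n n" using assms by (auto simp: M_def)
  have row: "row M i = rs ! i" if "i < length rs" for i
    unfolding M_def using that assms
    by (subst mat_of_rows_row) (auto simp: nth_append)
  have "det (transpose_mat M) = 0"
  proof -
    have "row M (n - 1) = 0\<^sub>v n"
      unfolding M_def using assms by (subst mat_of_rows_row) (auto simp: nth_append)
    then have "transpose_mat M *\<^sub>v unit_vec n (n - 1) = 0\<^sub>v n"
    proof (intro eq_vecI)
      fix i assume "i < dim_vec (0\<^sub>v n :: 'a vec)"
      then have i: "i < n" by simp
      have "row M (n - 1) $ i = 0" unfolding \<open>row M (n - 1) = 0\<^sub>v n\<close> using i by simp
      then show "(transpose_mat M *\<^sub>v unit_vec n (n - 1)) $ i = 0\<^sub>v n $ i"
        using M assms(2) i by simp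
    qed (use M in auto)
    moreover have "unit_vec n (n - 1) \<noteq> (0\<^sub>v n :: 'a vec)"
      using assms(2) by simp
    ultimately show ?thesis
      using M by (subst det_0_iff_vec_prod_zero_field[of _ n])
        (auto intro!: exI[of _ "unit_vec n (n - 1)"])
  qed
  then have "det M = 0" using det_transpose[OF M] by simp
  then obtain c where c: "c \<in> carrier_vec n" "c \<noteq> 0\<^sub>v n" "M *\<^sub>v c = 0\<^sub>v n"
    using M by (subst (asm) det_0_iff_vec_prod_zero_field[of _ n]) auto
  have "r \<bullet> c = 0" if "r \<in> set rs" for r
  proof -
    obtain i where i: "i < length rs" "r = rs ! i" using \<open>r \<in> set rs\<close> by (metis in_set_conv_nth)
    have "(M *\<^sub>v c) $ i = row M i \<bullet> c" using i M assms(2) by (intro index_mult_mat_vec) auto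
    then show ?thesis using i row c(3) assms(2) by simp
  qed
  then show ?thesis using c by blast
qed

text \<open>
  With \<open>u = A w\<close>, symmetry gives \<open>u* u = w* A u = 0\<close>. The vector \<open>w\<close> is complex because the
  triangularisation below takes place over the complex numbers, while the matrix has to be real.
\<close>

lemma real_symmetric_kernel_square:
  fixes A :: "real mat"
  assumes A: "A \<in> carrier_mat n n" "transpose_mat A = A"
    and w: "w \<in> carrier_vec n"
    and z: "map_mat complex_of_real A *\<^sub>v (map_mat complex_of_real A *\<^sub>v w) = 0\<^sub>v n"
  shows "map_mat complex_of_real A *\<^sub>v w = 0\<^sub>v n"
proof -
  let ?B = "map_mat complex_of_real A"
  have B: "?B \<in> carrier_mat n n" "transpose_mat ?B = ?B"
    using A by (auto simp: map_mat_transpose)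
  define u where "u = ?B *\<^sub>v w"
  have u: "u \<in> carrier_vec n" using B(1) w unfolding u_def by (metis mult_mat_vec_carrier)
  have cu: "conjugate u \<in> carrier_vec n" using u by simp
  have Bcu: "?B *\<^sub>v conjugate u = 0\<^sub>v n"
  proof (rule eq_vecI)
    fix i assume "i < dim_vec (0\<^sub>v n :: complex vec)"
    then have i: "i < n" by simp
    have "(?B *\<^sub>v conjugate u) $ i = cnj ((?B *\<^sub>v u) $ i)"
      using i A(1) u by (auto simp: scalar_prod_def)
    also have "(?B *\<^sub>v u) $ i = 0" using z i by (simp add: u_def)
    finally show "(?B *\<^sub>v conjugate u) $ i = 0\<^sub>v n $ i" using i by simp
  qed (use A in auto)
  have "u \<bullet>c u = conjugate u \<bullet> u" using comm_scalar_prod[OF u cu] by simp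
  also have "\<dots> = (transpose_mat ?B *\<^sub>v conjugate u) \<bullet> w"
    unfolding u_def by (rule transpose_vec_mult_scalar[OF B(1) w, symmetric]) (use u u_def in auto)
  also have "\<dots> = 0" unfolding B(2) Bcu using w by simp
  finally have "u \<bullet>c u = 0" .
  then show ?thesis using conjugate_square_eq_0_vec[OF u] by (simp add: u_def)
qed


lemma mult_mat_vec_vanishing_columns:
  fixes M :: "'a::comm_ring_1 mat"
  assumes M: "M \<in> carrier_mat m n" and c: "c \<in> carrier_vec n"
    and z: "\<And>i. i < n \<Longrightarrow> c $ i = 0 \<or> col M i = 0\<^sub>v m"
  shows "M *\<^sub>v c = 0\<^sub>v m"
proof (rule eq_vecI)
  fix r assume "r < dim_vec (0\<^sub>v m :: 'a vec)"
  then have r: "r < m" by simp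
  have "M $$ (r, i) * c $ i = 0" if i: "i < n" for i
    using z[OF i] M r i by (metis carrier_matD index_col index_zero_vec(1) mult_zero_left mult_zero_right)
  then show "(M *\<^sub>v c) $ r = 0\<^sub>v m $ r"
    using M c r by (auto simp: scalar_prod_def intro!: sum.neutral)
qed (use M in auto)

text \<open>
  The multiplicity of an eigenvalue of a real symmetric matrix is bounded by the dimension of its
  eigenspace, in the form of \<open>k\<close> columns of an invertible matrix \<open>P\<close> that lie in the eigenspace.
  Schur triangularisation with the eigenvalue \<open>x\<close> listed first yields a flag of length \<open>k\<close> along
  which \<open>A - x\<close> is nilpotent. By induction along the flag, \<open>(A - x)\<^sup>2\<close> annihilates each of these
  \<open>k\<close> columns, and then so does \<open>A - x\<close>.
\<close>

lemma order_char_poly_kernel_columns: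
  fixes A :: "real mat" and x :: real
  assumes A: "A \<in> carrier_mat n n" "transpose_mat A = A"
  defines "D \<equiv> map_mat complex_of_real (A + (- x) \<cdot>\<^sub>m 1\<^sub>m n)"
  defines "k \<equiv> Polynomial.order x (char_poly A)"
  shows "\<exists>P Q. P \<in> carrier_mat n n \<and> Q \<in> carrier_mat n n \<and> Q * P = 1\<^sub>m n \<and> k \<le> n \<and>
           (\<forall>j<k. col (D * P) j = 0\<^sub>v n)"
proof -
  let ?x = "complex_of_real x" and ?C = "map_mat complex_of_real A"
  have C: "?C \<in> carrier_mat n n" using A by simp
  have monic: "lead_coeff (char_poly ?C) = 1" using degree_monic_char_poly[OF C] by simp
  have "[:- x, 1:] ^ k dvd char_poly A" unfolding k_def by (rule order_1)
  then obtain q' where "char_poly A = [:- x, 1:] ^ k * q'" by (elim dvdE)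
  then have "char_poly ?C = map_poly complex_of_real ([:- x, 1:] ^ k * q')"
    using of_real_hom.char_poly_hom[OF A(1)] by simp
  interpret map_poly_idom_hom complex_of_real by unfold_locales
  have "char_poly ?C = [:- ?x, 1:] ^ k * map_poly complex_of_real q'"
    unfolding \<open>char_poly ?C = map_poly _ _\<close> by (simp add: hom_mult hom_power)
  then obtain q where q: "char_poly ?C = [:- ?x, 1:] ^ k * q" by blast
  have "lead_coeff q = 1" using monic unfolding q by (simp add: lead_coeff_mult lead_coeff_power)
  moreover obtain as where "Polynomial.smult (lead_coeff q) (\<Prod>a\<leftarrow>as. [:- a, 1:]) = q"
    using fundamental_theorem_algebra_factorized by blast
  ultimately have as: "q = (\<Prod>a\<leftarrow>as. [:- a, 1:])" by simp
  define es where "es = replicate k ?x @ as"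
  have es: "char_poly ?C = (\<Prod>a\<leftarrow>es. [:- a, 1:])"
    by (simp add: q as es_def)
  obtain U P Q where "schur_decomposition ?C es = (U, P, Q)" by (metis prod_cases3)
  from schur_decomposition[OF C es this]
  have sim: "similar_mat_wit ?C U P Q" and ut: "upper_triangular U" and diag: "diag_mat U = es" by auto
  from similar_mat_witD2[OF C sim]
  have PQ: "Q * P = 1\<^sub>m n" and CU: "?C = P * U * Q"
    and U: "U \<in> carrier_mat n n" and P: "P \<in> carrier_mat n n" and Q: "Q \<in> carrier_mat n n"
    by auto
  have "length (diag_mat U) = n" using U by (simp add: diag_mat_def)
  then have kn: "k \<le> n" by (simp add: diag es_def)
  have Ujj: "U $$ (j, j) = ?x" if "j < k" for j
  proof -
    have "diag_mat U ! j = U $$ (j, j)" using that kn U by (simp add: diag_mat_def)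
    then show ?thesis using that by (simp add: diag es_def nth_append)
  qed
  have D: "D \<in> carrier_mat n n" unfolding D_def using A by simp
  have Ax: "A + (- x) \<cdot>\<^sub>m 1\<^sub>m n \<in> carrier_mat n n"
    "transpose_mat (A + (- x) \<cdot>\<^sub>m 1\<^sub>m n) = A + (- x) \<cdot>\<^sub>m 1\<^sub>m n"
  proof -
    show "A + (- x) \<cdot>\<^sub>m 1\<^sub>m n \<in> carrier_mat n n" using A(1) by simp
    have "A $$ (j, i) = A $$ (i, j)" if "i < n" "j < n" for i j
      using arg_cong[OF A(2), of "\<lambda>M. M $$ (i, j)"] A(1) that by simp
    then show "transpose_mat (A + (- x) \<cdot>\<^sub>m 1\<^sub>m n) = A + (- x) \<cdot>\<^sub>m 1\<^sub>m n"
      using A(1) by (intro eq_matI) auto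
  qed
  have DC: "D = ?C + (- ?x) \<cdot>\<^sub>m 1\<^sub>m n" unfolding D_def by (rule eq_matI) (use A in auto)
  define N where "N = U + (- ?x) \<cdot>\<^sub>m 1\<^sub>m n"
  have N: "N \<in> carrier_mat n n" using U by (simp add: N_def)
  have CP: "?C * P = P * U"
  proof -
    have "?C * P = P * U * (Q * P)" unfolding CU using P U Q by (simp add: assoc_mult_mat[of _ n n _ n _ n])
    then show ?thesis using PQ P U by (simp add: right_mult_one_mat[of _ n n])
  qed
  have DP: "D * P = P * N"
  proof -
    have "D * P = ?C * P + ((- ?x) \<cdot>\<^sub>m 1\<^sub>m n) * P"
      unfolding DC by (rule add_mult_distrib_mat) (use C P in auto)
    also have "((- ?x) \<cdot>\<^sub>m 1\<^sub>m n) * P = P * ((- ?x) \<cdot>\<^sub>m 1\<^sub>m n)"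
      using P by (simp add: mult_smult_assoc_mat[of _ n n _ n] mult_smult_distrib[of _ n n _ n])
    also have "?C * P + P * ((- ?x) \<cdot>\<^sub>m 1\<^sub>m n) = P * N"
      unfolding CP N_def by (rule mult_add_distrib_mat[symmetric]) (use U P in auto)
    finally show ?thesis .
  qed
  have "col (D * P) j = 0\<^sub>v n" if "j < k" for j
    using that
  proof (induction j rule: less_induct)
    case (less j)
    have jn: "j < n" using less.prems kn by simp
    have DPj: "D *\<^sub>v col P j = P *\<^sub>v col N j"
      using DP col_mult2[OF D P jn] col_mult2[OF P N jn] by simp
    have "D *\<^sub>v (D *\<^sub>v col P j) = (D * P) *\<^sub>v col N j"
      unfolding DPj using D P N jn by (intro assoc_mult_mat_vec[symmetric]) auto
    also have "\<dots> = 0\<^sub>v n"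
    proof (rule mult_mat_vec_vanishing_columns)
      fix i assume i: "i < n"
      show "col N j $ i = 0 \<or> col (D * P) i = 0\<^sub>v n"
      proof (cases "i < j")
        case True
        then show ?thesis using less by simp
      next
        case False
        then show ?thesis using ut U i jn Ujj[OF less.prems]
          by (cases "i = j") (auto simp: N_def upper_triangular_def)
      qed
    qed (use D P N jn in auto)
    finally have "D *\<^sub>v (D *\<^sub>v col P j) = 0\<^sub>v n" .
    moreover have "col P j \<in> carrier_vec n" using P jn by auto
    ultimately have "D *\<^sub>v col P j = 0\<^sub>v n"
      unfolding D_def by (rule real_symmetric_kernel_square[OF Ax, rotated])
    then show ?case using col_mult2[OF D P jn] by simp
  qed
  then show ?thesis using P Q PQ kn by blast
qed

text \<open>
  If the multiplicity exceeded \<open>card Z\<close>, a nontrivial combination of the \<open>k\<close> independent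
  eigenvectors would vanish on \<open>Z\<close>.
\<close>

lemma order_char_poly_le_card:
  fixes A :: "real mat" and x :: real
  assumes A: "A \<in> carrier_mat n n" "transpose_mat A = A"
    and Z: "finite Z" "Z \<subseteq> {..<n}"
    and zero: "\<And>w. w \<in> carrier_vec n \<Longrightarrow>
        map_mat complex_of_real (A + (- x) \<cdot>\<^sub>m 1\<^sub>m n) *\<^sub>v w = 0\<^sub>v n \<Longrightarrow>
        (\<And>i. i \<in> Z \<Longrightarrow> w $ i = 0) \<Longrightarrow> w = 0\<^sub>v n"
  shows "Polynomial.order x (char_poly A) \<le> card Z"
proof (rule ccontr)
  define k where "k = Polynomial.order x (char_poly A)"
  define D where "D = map_mat complex_of_real (A + (- x) \<cdot>\<^sub>m 1\<^sub>m n)"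
  assume "\<not> Polynomial.order x (char_poly A) \<le> card Z"
  then have less: "card Z < k" by (simp add: k_def)
  obtain P Q where P: "P \<in> carrier_mat n n" and Q: "Q \<in> carrier_mat n n"
    and QP: "Q * P = 1\<^sub>m n" and kn: "k \<le> n" and ker: "\<And>j. j < k \<Longrightarrow> col (D * P) j = 0\<^sub>v n"
    using order_char_poly_kernel_columns[OF A, of x] unfolding k_def D_def by blast
  have D: "D \<in> carrier_mat n n" using A by (simp add: D_def)
  \<comment> \<open>The equations say that \<open>P c\<close> vanishes on \<open>Z\<close> and that \<open>c\<close> only involves the first \<open>k\<close> columns.\<close>
  define rs where "rs = map (row P) (sorted_list_of_set Z) @ map (unit_vec n) [k..<n]"
  have "length rs < n" using less kn by (simp add: rs_def)
  moreover have "set rs \<subseteq> carrier_vec n" using P by (auto simp: rs_def)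
  ultimately obtain c where c: "c \<in> carrier_vec n" "c \<noteq> 0\<^sub>v n" and rs: "\<And>r. r \<in> set rs \<Longrightarrow> r \<bullet> c = 0"
    using underdetermined_system by blast
  define w where "w = P *\<^sub>v c"
  have w: "w \<in> carrier_vec n" using P c by (simp add: w_def)
  have "c = Q *\<^sub>v w"
    unfolding w_def using assoc_mult_mat_vec[OF Q P c(1)] QP c(1) by simp
  then have "w \<noteq> 0\<^sub>v n" using c(2) Q by auto
  moreover have "w $ i = 0" if "i \<in> Z" for i
  proof -
    have "row P i \<bullet> c = 0" using that Z by (intro rs) (auto simp: rs_def)
    then show ?thesis using that Z P by (auto simp: w_def)
  qed
  moreover have "D *\<^sub>v w = 0\<^sub>v n"
  proof -
    have "D *\<^sub>v w = (D * P) *\<^sub>v c"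
      unfolding w_def by (rule assoc_mult_mat_vec[OF D P c(1), symmetric])
    also have "\<dots> = 0\<^sub>v n"
    proof (rule mult_mat_vec_vanishing_columns)
      fix i assume i: "i < n"
      show "c $ i = 0 \<or> col (D * P) i = 0\<^sub>v n"
      proof (cases "i < k")
        case False
        have "unit_vec n i \<bullet> c = 0" using False i by (intro rs) (auto simp: rs_def)
        then show ?thesis using i c by simp
      qed (use ker in simp)
    qed (use D P c in auto)
    finally show ?thesis .
  qed
  ultimately show False using zero[OF w] by (simp add: D_def)
qed

text \<open>
  In each product of the Leibniz formula, the columns in \<open>J\<close> contribute \<open>card J\<close> factors, and at
  most \<open>card I\<close> of them come from rows in \<open>I\<close>.
\<close>

lemma power_dvd_det:
  fixes N :: "'a::comm_ring_1 mat"
  assumes N: "N \<in> carrier_mat n n" and J: "J \<subseteq> {..<n}" and I: "I \<subseteq> {..<n}"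
    and dvd: "\<And>i j. i < n \<Longrightarrow> i \<notin> I \<Longrightarrow> j \<in> J \<Longrightarrow> d dvd N $$ (i, j)"
  shows "d ^ (card J - card I) dvd det N"
proof -
  have fin: "finite J" "finite I" using J I finite_subset by auto
  have "d ^ (card J - card I) dvd (\<Prod>i = 0..<n. N $$ (i, p i))" if p: "p permutes {0..<n}" for p
  proof -
    define K where "K = {i \<in> {0..<n}. p i \<in> J \<and> i \<notin> I}"
    have "J \<subseteq> p ` (K \<union> I)"
    proof
      fix j assume j: "j \<in> J"
      then have "j \<in> p ` {0..<n}" using J permutes_image[OF p] by auto
      then obtain i where "i \<in> {0..<n}" "j = p i" by blast
      then show "j \<in> p ` (K \<union> I)" using j by (cases "i \<in> I") (auto simp: K_def)
    qed
    then have "card J \<le> card (p ` (K \<union> I))"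
      using fin by (intro card_mono) (auto simp: K_def)
    also have "\<dots> \<le> card (K \<union> I)" using fin by (intro card_image_le) (auto simp: K_def)
    also have "\<dots> \<le> card K + card I" by (rule card_Un_le)
    finally have "d ^ (card J - card I) dvd d ^ card K" by (intro le_imp_power_dvd) simp
    also have "d ^ card K = (\<Prod>i\<in>K. d)" by simp
    also have "\<dots> dvd (\<Prod>i\<in>K. N $$ (i, p i))"
      by (rule prod_dvd_prod) (auto simp: K_def intro: dvd)
    also have "\<dots> dvd (\<Prod>i = 0..<n. N $$ (i, p i))"
      by (rule prod_dvd_prod_subset) (auto simp: K_def)
    finally show ?thesis .
  qed
  then show ?thesis
    using N by (auto simp: det_def intro!: dvd_sum intro: dvd_mult)
qed

text \<open>
  The indicator vector of a block is mapped by \<open>A\<close> to a vector supported on \<open>S\<close>. In the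
  characteristic matrix \<open>X - A\<close>, replace the column of the least index in each block by the sum of
  all columns of the block: outside of the rows in \<open>S\<close>, the new column is \<open>X\<close> times the indicator
  vector. The replacement is multiplication by a unitriangular matrix \<open>T\<close>, so it does not change
  the determinant.
\<close>

lemma order_char_poly_ge_blocks:
  fixes A :: "'a::field mat"
  assumes A: "A \<in> carrier_mat n n"
    and S: "S \<subseteq> {..<n}" and Q: "partition_on ({..<n} - S) Q"
    and ker: "\<And>i C. i < n \<Longrightarrow> i \<notin> S \<Longrightarrow> C \<in> Q \<Longrightarrow> (\<Sum>j\<in>C. A $$ (i, j)) = 0"
  shows "card Q - card S \<le> Polynomial.order 0 (char_poly A)"
proof -
  let ?X = "[:0, 1:] :: 'a poly"
  have Qn: "C \<subseteq> {..<n}" "finite C" "C \<noteq> {}" if "C \<in> Q" for C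
    using Q that unfolding partition_on_def by (auto intro: finite_subset[of C "{..<n}"])
  have MinC: "Min C \<in> C" if "C \<in> Q" for C using Qn[OF that] by (intro Min_in) auto
  have uniq: "C = C'" if "C \<in> Q" "C' \<in> Q" "i \<in> C" "i \<in> C'" for C C' i
    using Q that unfolding partition_on_def disjoint_def by blast
  have inj: "inj_on Min Q" using MinC uniq by (metis inj_onI)
  define J where "J = Min ` Q"
  have J: "J \<subseteq> {..<n}" unfolding J_def using MinC Qn(1) by blast
  have cardJ: "card J = card Q" unfolding J_def by (rule card_image[OF inj])
  define T :: "'a poly mat" where
    "T = mat n n (\<lambda>(i, j). if i = j \<or> (\<exists>C\<in>Q. i \<in> C \<and> j = Min C) then 1 else 0)"
  have T: "T \<in> carrier_mat n n" by (simp add: T_def)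
  have "det T = prod_list (diag_mat T)"
  proof (rule det_lower_triangular[OF _ T])
    fix i j :: nat assume "i < j" "j < n"
    moreover have "\<not> (i \<in> C \<and> j = Min C)" if "C \<in> Q" for C
      using Qn[OF that] \<open>i < j\<close> by (metis Min_le leD)
    ultimately show "T $$ (i, j) = 0" by (auto simp: T_def)
  qed
  also have "diag_mat T = replicate n 1" by (rule nth_equalityI) (auto simp: diag_mat_def T_def)
  finally have detT: "det T = 1" by simp
  define M where "M = char_poly_matrix A"
  have M: "M \<in> carrier_mat n n" using A by (simp add: M_def)
  have Mij: "M $$ (i, j) = (if i = j then ?X else 0) - [:A $$ (i, j):]" if "i < n" "j < n" for i j
    using A that by (auto simp: M_def char_poly_matrix_def)
  have "?X dvd (M * T) $$ (i, j)" if i: "i < n" "i \<notin> S" and j: "j \<in> J" for i j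
  proof -
    obtain C where C: "C \<in> Q" "j = Min C" using j by (auto simp: J_def)
    have jn: "j < n" using J j by auto
    have Tlj: "T $$ (l, j) = (if l \<in> C then 1 else 0)" if "l < n" for l
    proof -
      have "(l = j \<or> (\<exists>C'\<in>Q. l \<in> C' \<and> j = Min C')) \<longleftrightarrow> l \<in> C"
        using inj C MinC[OF C(1)] unfolding inj_on_def by blast
      then show ?thesis using that jn by (simp add: T_def)
    qed
    have "(M * T) $$ (i, j) = (\<Sum>l = 0..<n. M $$ (i, l) * T $$ (l, j))"
      using M T i jn by (auto simp: scalar_prod_def)
    also have "\<dots> = (\<Sum>l = 0..<n. if l \<in> C then M $$ (i, l) else 0)"
      by (intro sum.cong) (auto simp: Tlj)
    also have "\<dots> = (\<Sum>l\<in>C. M $$ (i, l))"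
    proof -
      have "{0..<n} \<inter> C = C" using Qn[OF C(1)] by auto
      then show ?thesis by (simp add: sum.inter_restrict[symmetric])
    qed
    also have "\<dots> = (\<Sum>l\<in>C. (if i = l then ?X else 0) - [:A $$ (i, l):])"
      using Qn[OF C(1)] i by (intro sum.cong) (auto simp: Mij)
    also have "\<dots> = (\<Sum>l\<in>C. if i = l then ?X else 0) - [:\<Sum>l\<in>C. A $$ (i, l):]"
    proof -
      have "(\<Sum>l\<in>C. [:A $$ (i, l):]) = [:\<Sum>l\<in>C. A $$ (i, l):]"
        by (induction C rule: infinite_finite_induct) auto
      then show ?thesis by (simp add: sum_subtractf)
    qed
    also have "\<dots> = (\<Sum>l\<in>C. if i = l then ?X else 0)" using ker[OF i C(1)] by simp
    also have "?X dvd \<dots>" by (rule dvd_sum) simp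
    finally show ?thesis .
  qed
  then have "?X ^ (card J - card S) dvd det (M * T)"
    using M T by (intro power_dvd_det[OF _ J S]) auto
  also have "det (M * T) = char_poly A"
    using det_mult[OF M T] detT by (simp add: M_def char_poly_def)
  finally have "[:- 0, 1:] ^ (card Q - card S) dvd char_poly A" by (simp add: cardJ)
  moreover have "char_poly A \<noteq> 0" using degree_monic_char_poly[OF A] by auto
  ultimately show ?thesis using order_divides[of 0 "card Q - card S" "char_poly A"] by simp
qed

section \<open>Matrices of a graph\<close>

context graph
begin

lemma sym_mats_numbering:
  assumes "A \<in> sym_mats G"
  obtains \<phi> where "bij_betw \<phi> {..<card (verts G)} (verts G)"
    and "\<And>i j. i < card (verts G) \<Longrightarrow> j < card (verts G) \<Longrightarrow> i \<noteq> j \<Longrightarrow>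
           A $$ (i, j) \<noteq> 0 \<longleftrightarrow> (\<phi> i, \<phi> j) \<in> arcs_ends G"
proof -
  let ?n = "card (verts G)" and ?H = "with_proj (graph_of_mat A)"
  have A: "A \<in> carrier_mat ?n ?n" and "digraph_iso ?H G" using assms by (auto simp: sym_mats_def)
  then obtain h where h: "pre_digraph.digraph_isomorphism ?H h" and G: "G = app_iso h ?H"
    by (auto simp: digraph_iso_def)
  let ?\<phi> = "iso_verts h"
  have inj: "inj_on ?\<phi> {..<?n}" using h A by (simp add: pre_digraph.digraph_isomorphism_def graph_of_mat_def)
  have "?\<phi> ` {..<?n} = verts G" using arg_cong[OF G, of verts] A by (simp add: graph_of_mat_def)
  then have bij: "bij_betw ?\<phi> {..<?n} (verts G)" using inj by (simp add: bij_betw_def)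
  have "arcs_ends G = (\<lambda>(u, v). (?\<phi> u, ?\<phi> v)) ` arcs_ends ?H"
    using wf_digraph.arcs_ends_app_iso_eq[OF _ h] h G by (simp add: pre_digraph.digraph_isomorphism_def)
  also have "arcs_ends ?H = {(i, j). i < ?n \<and> j < ?n \<and> i \<noteq> j \<and> A $$ (i, j) \<noteq> 0}"
    using A by (simp add: graph_of_mat_def)
  finally have E: "arcs_ends G = (\<lambda>(u, v). (?\<phi> u, ?\<phi> v)) `
      {(i, j). i < ?n \<and> j < ?n \<and> i \<noteq> j \<and> A $$ (i, j) \<noteq> 0}" .
  have "A $$ (i, j) \<noteq> 0 \<longleftrightarrow> (?\<phi> i, ?\<phi> j) \<in> arcs_ends G" if "i < ?n" "j < ?n" "i \<noteq> j" for i j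
  proof -
    have "?\<phi> a = ?\<phi> b \<longleftrightarrow> a = b" if "a < ?n" "b < ?n" for a b
      using inj_on_eq_iff[OF inj] that by simp
    then show ?thesis using that unfolding E by (auto simp: image_iff)
  qed
  then show ?thesis using bij that by blast
qed

text \<open>
  Since \<open>G\<close> has no parallel arcs, a numbering of the vertices already determines the map between
  the arcs.
\<close>

lemma sym_matsI:
  assumes A: "A \<in> carrier_mat (card (verts G)) (card (verts G))" "transpose_mat A = A"
    and bij: "bij_betw \<phi> {..<card (verts G)} (verts G)"
    and adj: "\<And>i j. i < card (verts G) \<Longrightarrow> j < card (verts G) \<Longrightarrow> i \<noteq> j \<Longrightarrow>
           A $$ (i, j) \<noteq> 0 \<longleftrightarrow> (\<phi> i, \<phi> j) \<in> arcs_ends G"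
  shows "A \<in> sym_mats G"
proof -
  let ?n = "card (verts G)" and ?H = "with_proj (graph_of_mat A)"
  let ?e = "the_inv_into (arcs G) (arc_to_ends G)"
  have inj: "inj_on (arc_to_ends G) (arcs G)" by (rule inj_on_arc_to_ends)
  have \<phi>: "inj_on \<phi> {..<?n}" "\<phi> ` {..<?n} = verts G" using bij by (auto simp: bij_betw_def)
  have arcsH: "arcs ?H = {(i, j). i < ?n \<and> j < ?n \<and> i \<noteq> j \<and> A $$ (i, j) \<noteq> 0}"
    and vertsH: "verts ?H = {..<?n}" using A by (simp_all add: graph_of_mat_def)
  define h where "h = \<lparr>iso_verts = \<phi>, iso_arcs = (\<lambda>(i, j). ?e (\<phi> i, \<phi> j)),
     iso_head = head G, iso_tail = tail G\<rparr>"
  have e: "?e (\<phi> i, \<phi> j) \<in> arcs G" "tail G (?e (\<phi> i, \<phi> j)) = \<phi> i" "head G (?e (\<phi> i, \<phi> j)) = \<phi> j"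
    if "(i, j) \<in> arcs ?H" for i j
  proof -
    have "(\<phi> i, \<phi> j) \<in> arc_to_ends G ` arcs G"
      using that adj[of i j] unfolding arcsH by (auto simp: arcs_ends_def)
    then show "?e (\<phi> i, \<phi> j) \<in> arcs G" using inj by (intro the_inv_into_into) auto
    have "arc_to_ends G (?e (\<phi> i, \<phi> j)) = (\<phi> i, \<phi> j)"
      using inj \<open>(\<phi> i, \<phi> j) \<in> _\<close> by (intro f_the_inv_into_f) auto
    then show "tail G (?e (\<phi> i, \<phi> j)) = \<phi> i" "head G (?e (\<phi> i, \<phi> j)) = \<phi> j"
      by (simp_all add: arc_to_ends_def)
  qed
  have img: "(\<lambda>(i, j). ?e (\<phi> i, \<phi> j)) ` arcs ?H = arcs G"
  proof (intro equalityI subsetI)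
    fix a assume "a \<in> (\<lambda>(i, j). ?e (\<phi> i, \<phi> j)) ` arcs ?H"
    then show "a \<in> arcs G" using e(1) by auto
  next
    fix a assume a: "a \<in> arcs G"
    then have "tail G a \<in> \<phi> ` {..<?n}" "head G a \<in> \<phi> ` {..<?n}" using \<phi>(2) by auto
    then obtain i j where ij: "i < ?n" "j < ?n" "tail G a = \<phi> i" "head G a = \<phi> j" by auto
    have "(\<phi> i, \<phi> j) \<in> arcs_ends G" using in_arcs_imp_in_arcs_ends[OF a] ij by simp
    moreover have "i \<noteq> j" using no_loops[OF a] ij by auto
    ultimately have "(i, j) \<in> arcs ?H" unfolding arcsH using adj[OF ij(1,2)] ij by auto
    moreover have "?e (\<phi> i, \<phi> j) = a"
      using the_inv_into_f_f[OF inj a] ij by (simp add: arc_to_ends_def)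
    ultimately show "a \<in> (\<lambda>(i, j). ?e (\<phi> i, \<phi> j)) ` arcs ?H" by force
  qed
  have "wf_digraph ?H" by unfold_locales (auto simp: graph_of_mat_def)
  moreover have "inj_on (\<lambda>(i, j). ?e (\<phi> i, \<phi> j)) (arcs ?H)"
  proof (rule inj_onI, clarify)
    fix i j k l assume a: "(i, j) \<in> arcs ?H" "(k, l) \<in> arcs ?H" and eq: "?e (\<phi> i, \<phi> j) = ?e (\<phi> k, \<phi> l)"
    have "\<phi> i = \<phi> k" "\<phi> j = \<phi> l" using e(2,3)[OF a(1)] e(2,3)[OF a(2)] eq by auto
    then show "i = k \<and> j = l" using a \<phi>(1) unfolding arcsH inj_on_def by auto
  qed
  ultimately have "pre_digraph.digraph_isomorphism ?H h"
    using \<phi>(1) vertsH e(2,3) unfolding pre_digraph.digraph_isomorphism_def h_def by auto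
  moreover have "G = app_iso h ?H"
    using img \<phi>(2) vertsH by (intro pre_digraph.equality) (auto simp: h_def)
  ultimately show ?thesis using A by (auto simp: sym_mats_def digraph_iso_def)
qed

text \<open>
  Off the diagonal the matrix is the negated adjacency matrix. A diagonal entry is the number of
  neighbors outside of \<open>S\<close>; for a vertex of a block these are its neighbors in the block, since
  different blocks are not adjacent, so that each row outside of \<open>S\<close> sums to zero over every
  block.
\<close>

lemma ex_sym_mat_order_ge:
  assumes S: "S \<subseteq> verts G" and Q: "partition_on (verts G - S) Q" "separated (arcs_ends G) Q"
  shows "\<exists>A\<in>sym_mats G. card Q - card S \<le> Polynomial.order 0 (char_poly A)"
proof -
  let ?n = "card (verts G)" and ?E = "arcs_ends G" and ?X = "verts G - S"
  obtain \<phi> where bij: "bij_betw \<phi> {..<?n} (verts G)"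
    using ex_bij_betw_nat_finite[OF finite_verts] by (auto simp: atLeast0LessThan)
  have \<phi>: "inj_on \<phi> {..<?n}" "\<phi> ` {..<?n} = verts G" using bij by (auto simp: bij_betw_def)
  define A :: "real mat" where "A = mat ?n ?n (\<lambda>(i, j).
     if i = j then of_nat (card {l. l < ?n \<and> \<phi> l \<in> ?X \<and> (\<phi> i, \<phi> l) \<in> ?E})
     else if (\<phi> i, \<phi> j) \<in> ?E then - 1 else 0)"
  have sym: "(a, b) \<in> ?E \<longleftrightarrow> (b, a) \<in> ?E" for a b using symD[OF sym_arcs_ends] by blast
  have irr: "(a, a) \<notin> ?E" for a using irrefl_arcs_ends by (simp add: irrefl_def)
  have A: "A \<in> carrier_mat ?n ?n" "transpose_mat A = A"
    using sym by (auto simp: A_def intro!: eq_matI)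
  have AG: "A \<in> sym_mats G" by (rule sym_matsI[OF A bij]) (auto simp: A_def)
  define pre where "pre C = {i. i < ?n \<and> \<phi> i \<in> C}" for C
  have img: "\<phi> ` pre C = C" if "C \<subseteq> verts G" for C
    using that \<phi>(2) unfolding pre_def by (auto simp: image_iff)
  have QV: "C \<subseteq> verts G" "C \<noteq> {}" if "C \<in> Q" for C using Q(1) that by (auto simp: partition_on_def)
  have "partition_on ({..<?n} - pre S) (pre ` Q)"
  proof (rule partition_onI)
    show "\<Union> (pre ` Q) = {..<?n} - pre S"
    proof -
      have "\<phi> i \<in> \<Union>Q \<longleftrightarrow> \<phi> i \<notin> S" if "i < ?n" for i
        using partition_onD1[OF Q(1)] \<phi>(2) that by blast
      then show ?thesis by (auto simp: pre_def)
    qed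
    show "disjnt p q" if pq: "p \<in> pre ` Q" "q \<in> pre ` Q" "p \<noteq> q" for p q
    proof -
      obtain C D where CD: "C \<in> Q" "D \<in> Q" "p = pre C" "q = pre D" using pq by auto
      then have "C \<noteq> D" using pq(3) by blast
      then have "C \<inter> D = {}" using CD(1,2) partition_onD2[OF Q(1)] unfolding disjoint_def by blast
      then show ?thesis by (auto simp: CD pre_def disjnt_def)
    qed
    show "{} \<notin> pre ` Q"
    proof
      assume "{} \<in> pre ` Q"
      then obtain C where "C \<in> Q" "pre C = {}" by auto
      then show False using img[OF QV(1)] QV(2) by force
    qed
  qed
  moreover have "(\<Sum>j\<in>C'. A $$ (i, j)) = 0" if i: "i < ?n" "i \<notin> pre S" and C': "C' \<in> pre ` Q" for i C'
  proof -
    obtain C where C: "C \<in> Q" "C' = pre C" using C' by auto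
    have iX: "\<phi> i \<in> ?X" using i \<phi>(2) by (auto simp: pre_def)
    then obtain D where D: "D \<in> Q" "\<phi> i \<in> D" using partition_onD1[OF Q(1)] by blast
    have fin: "finite C'" by (simp add: C pre_def)
    show ?thesis
    proof (cases "C = D")
      case False
      have "A $$ (i, j) = 0" if "j \<in> C'" for j
      proof -
        have j: "j < ?n" "\<phi> j \<in> C" using that C by (auto simp: pre_def)
        then have "(\<phi> i, \<phi> j) \<notin> ?E" using Q(2) False D C(1) unfolding separated_def by blast
        moreover have "i \<noteq> j" using j D C(1) False Q(1) unfolding partition_on_def disjoint_def by blast
        ultimately show ?thesis using i j by (simp add: A_def)
      qed
      then show ?thesis by simp
    next
      case True
      have iC: "i \<in> C'" using D True i C by (simp add: pre_def)
      define N where "N = {l. l < ?n \<and> \<phi> l \<in> ?X \<and> (\<phi> i, \<phi> l) \<in> ?E}"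
      have sub: "l \<in> C' - {i}" if l: "l \<in> N" for l
      proof -
        obtain D' where D': "D' \<in> Q" "\<phi> l \<in> D'" using l partition_onD1[OF Q(1)] by (auto simp: N_def)
        then have "D' = D" using Q(2) D l unfolding separated_def N_def by blast
        then show ?thesis using l D' C True irr by (auto simp: N_def pre_def)
      qed
      have inX: "l < ?n \<and> \<phi> l \<in> ?X" if l: "l \<in> C'" for l
      proof -
        have "l < ?n" "\<phi> l \<in> C" using l C(2) by (auto simp: pre_def)
        then show ?thesis using C(1) partition_onD1[OF Q(1)] by blast
      qed
      have N: "N = {l \<in> C' - {i}. (\<phi> i, \<phi> l) \<in> ?E}"
      proof (intro equalityI subsetI)
        fix l assume "l \<in> N"
        then show "l \<in> {l \<in> C' - {i}. (\<phi> i, \<phi> l) \<in> ?E}" using sub[of l] by (simp add: N_def)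
      next
        fix l assume "l \<in> {l \<in> C' - {i}. (\<phi> i, \<phi> l) \<in> ?E}"
        then show "l \<in> N" using inX[of l] unfolding N_def by blast
      qed
      have "(\<Sum>j\<in>C'. A $$ (i, j)) = A $$ (i, i) + (\<Sum>j\<in>C' - {i}. A $$ (i, j))"
        by (rule sum.remove[OF fin iC])
      also have "(\<Sum>j\<in>C' - {i}. A $$ (i, j)) = (\<Sum>j\<in>C' - {i}. if (\<phi> i, \<phi> j) \<in> ?E then - 1 else 0)"
        using i C by (intro sum.cong) (auto simp: A_def pre_def)
      also have "\<dots> = (\<Sum>j\<in>N. - 1)" unfolding N using fin by (intro sum.inter_filter[symmetric]) simp
      also have "A $$ (i, i) = of_nat (card N)" using i by (simp add: A_def N_def)
      finally show ?thesis by simp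
    qed
  qed
  ultimately have "card (pre ` Q) - card (pre S) \<le> Polynomial.order 0 (char_poly A)"
    by (intro order_char_poly_ge_blocks[OF A(1)]) (auto simp: pre_def)
  moreover have "card (pre ` Q) = card Q"
    using img QV(1) by (intro card_image inj_onI) metis
  moreover have "card (pre S) = card S"
  proof -
    have "inj_on \<phi> (pre S)" using \<phi>(1) by (rule inj_on_subset) (auto simp: pre_def)
    then show ?thesis using card_image[of \<phi> "pre S"] img[OF S] by simp
  qed
  ultimately show ?thesis using AG by auto
qed

text \<open>
  When \<open>u\<close> forces \<open>v\<close>, row \<open>u\<close> of the eigenvector equation has \<open>v\<close> as its only entry that could be
  nonzero. The diagonal entry does no harm, because \<open>u\<close> itself is already colored.
\<close>

lemma order_sym_mat_le_zero_forcing: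
  assumes A: "A \<in> sym_mats G" and Z: "zero_forcing_set G Z"
  shows "Polynomial.order x (char_poly A) \<le> card Z"
proof -
  let ?n = "card (verts G)" and ?E = "arcs_ends G"
  obtain \<phi> where bij: "bij_betw \<phi> {..<?n} (verts G)"
    and adj: "\<And>i j. i < ?n \<Longrightarrow> j < ?n \<Longrightarrow> i \<noteq> j \<Longrightarrow> A $$ (i, j) \<noteq> 0 \<longleftrightarrow> (\<phi> i, \<phi> j) \<in> ?E"
    using sym_mats_numbering[OF A] by blast
  have \<phi>: "inj_on \<phi> {..<?n}" "\<phi> ` {..<?n} = verts G" using bij by (auto simp: bij_betw_def)
  have Am: "A \<in> carrier_mat ?n ?n" "transpose_mat A = A" using A by (auto simp: sym_mats_def)
  define pre where "pre C = {i. i < ?n \<and> \<phi> i \<in> C}" for C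
  have ZV: "Z \<subseteq> verts G" and steps: "(color_step G)\<^sup>*\<^sup>* Z (verts G)" using Z by (auto simp: zero_forcing_set_def)
  have "\<phi> ` pre Z = Z"
    using ZV \<phi>(2) unfolding pre_def by (auto simp: image_iff)
  moreover have "inj_on \<phi> (pre Z)" using \<phi>(1) by (rule inj_on_subset) (auto simp: pre_def)
  ultimately have "card (pre Z) = card Z" using card_image by fastforce
  moreover have "Polynomial.order x (char_poly A) \<le> card (pre Z)"
  proof (rule order_char_poly_le_card[OF Am])
    show "finite (pre Z)" "pre Z \<subseteq> {..<?n}" by (auto simp: pre_def)
    fix w :: "complex vec"
    let ?D = "map_mat complex_of_real (A + (- x) \<cdot>\<^sub>m 1\<^sub>m ?n)"
    assume w: "w \<in> carrier_vec ?n" and ker: "?D *\<^sub>v w = 0\<^sub>v ?n" and z: "\<And>i. i \<in> pre Z \<Longrightarrow> w $ i = 0"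
    have "\<forall>i\<in>pre B. w $ i = 0" if "(color_step G)\<^sup>*\<^sup>* Z B" for B
      using that
    proof (induction rule: rtranclp_induct)
      case base
      then show ?case using z by simp
    next
      case (step B B')
      from step.hyps(2) obtain u v where u: "u \<in> B" and v: "{v. (u, v) \<in> ?E} - B = {v}" and B': "B' = insert v B"
        by (auto simp: color_step_def)
      have "(u, v) \<in> ?E" "v \<notin> B" using v by auto
      then have "u \<in> \<phi> ` {..<?n}" "v \<in> \<phi> ` {..<?n}" unfolding \<phi>(2) using arcs_ends_subset by blast+
      then obtain i j where i: "i < ?n" "\<phi> i = u" and j: "j < ?n" "\<phi> j = v" by auto
      have ij: "i \<noteq> j" using \<open>v \<notin> B\<close> u i j by auto
      have "0 = (?D *\<^sub>v w) $ i" using ker i by simp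
      also have "\<dots> = (\<Sum>l = 0..<?n. ?D $$ (i, l) * w $ l)"
        using i w Am by (auto simp: scalar_prod_def)
      also have "\<dots> = (\<Sum>l = 0..<?n. if l = j then ?D $$ (i, j) * w $ j else 0)"
      proof (rule sum.cong[OF refl])
        fix l assume "l \<in> {0..<?n}"
        then have l: "l < ?n" by simp
        show "?D $$ (i, l) * w $ l = (if l = j then ?D $$ (i, j) * w $ j else 0)"
        proof (cases "l = j \<or> \<phi> l \<in> B")
          case True
          then show ?thesis using step.IH l \<open>v \<notin> B\<close> j by (auto simp: pre_def)
        next
          case False
          then have "(u, \<phi> l) \<notin> ?E" using v l j \<phi>(1) by (auto simp: inj_on_def)
          moreover have "l \<noteq> i" using False u i by auto
          ultimately show ?thesis using adj[OF i(1) l] i l False Am by auto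
        qed
      qed
      also have "\<dots> = ?D $$ (i, j) * w $ j" using j by simp
      also have "?D $$ (i, j) = complex_of_real (A $$ (i, j))" using i j ij Am by simp
      finally have "w $ j = 0" using adj[OF i(1) j(1) ij] \<open>(u, v) \<in> ?E\<close> i j by simp
      moreover have "l = j" if "l < ?n" "\<phi> l = v" for l using that j \<phi>(1) by (auto simp: inj_on_def)
      ultimately show ?case using step.IH unfolding B' pre_def by auto
    qed
    then have "w $ i = 0" if "i < ?n" for i using steps \<phi>(2) that by (auto simp: pre_def)
    then show "w = 0\<^sub>v ?n" using w by (intro eq_vecI) auto
  qed
  ultimately show ?thesis by simp
qed

end

section \<open>Comparison of the parameters\<close>

context graph
begin

lemma max_mult_attained: "\<exists>A\<in>sym_mats G. \<exists>x. max_mult G = Polynomial.order x (char_poly A)"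
  and order_le_max_mult: "A \<in> sym_mats G \<Longrightarrow> Polynomial.order x (char_poly A) \<le> max_mult G"
proof -
  let ?M = "{Polynomial.order x (char_poly A) | A x. A \<in> sym_mats G}"
  have "Polynomial.order x (char_poly A) \<le> card (verts G)" if "A \<in> sym_mats G" for A x
  proof -
    have A: "A \<in> carrier_mat (card (verts G)) (card (verts G))" using that by (simp add: sym_mats_def)
    then have "char_poly A \<noteq> 0" using degree_monic_char_poly[OF A] by auto
    then show ?thesis using order_degree[of "char_poly A" x] degree_monic_char_poly[OF A] by simp
  qed
  then have "?M \<subseteq> {..card (verts G)}" by auto
  then have fin: "finite ?M" by (rule finite_subset) simp
  have "\<exists>A. A \<in> sym_mats G"
    using ex_sym_mat_order_ge[of "verts G" "{}"] by (auto simp: partition_on_empty separated_def)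
  then have "?M \<noteq> {}" by blast
  from Max_in[OF fin this] show "\<exists>A\<in>sym_mats G. \<exists>x. max_mult G = Polynomial.order x (char_poly A)"
    unfolding max_mult_def by blast
  show "Polynomial.order x (char_poly A) \<le> max_mult G" if "A \<in> sym_mats G"
    unfolding max_mult_def using that by (intro Max_ge[OF fin]) blast
qed

lemma zero_forcing_number_attained: "\<exists>Z. zero_forcing_set G Z \<and> zero_forcing_number G = card Z"
  and zero_forcing_number_le: "zero_forcing_set G Z \<Longrightarrow> zero_forcing_number G \<le> card Z"
proof -
  let ?M = "{card Z | Z. zero_forcing_set G Z}"
  have "?M \<subseteq> card ` Pow (verts G)" by (auto simp: zero_forcing_set_def)
  then have fin: "finite ?M" by (rule finite_subset) simp
  have "zero_forcing_set G (verts G)" by (simp add: zero_forcing_set_def)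
  then have "?M \<noteq> {}" by blast
  from Min_in[OF fin this] show "\<exists>Z. zero_forcing_set G Z \<and> zero_forcing_number G = card Z"
    unfolding zero_forcing_number_def by blast
  show "zero_forcing_number G \<le> card Z" if "zero_forcing_set G Z"
    unfolding zero_forcing_number_def using that by (intro Min_le[OF fin]) blast
qed

lemma Delta_attained: "\<exists>S p. S \<subseteq> verts G \<and> leaves_paths G S p \<and> Delta G = int p - int (card S)"
  and le_Delta: "S \<subseteq> verts G \<Longrightarrow> leaves_paths G S p \<Longrightarrow> int p - int (card S) \<le> Delta G"
  and Delta_plus_attained: "\<exists>S p. S \<subseteq> verts G \<and> leaves_paths G S p \<and> Delta_plus G = p + card S"
proof -
  let ?I = "{(S, p). S \<subseteq> verts G \<and> leaves_paths G S p}"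
  have "?I \<subseteq> (\<lambda>S. (S, card (pre_digraph.sccs (delete_verts G S)))) ` Pow (verts G)"
    by (auto simp: leaves_paths_def)
  then have fin: "finite ?I" by (rule finite_subset) simp
  have "leaves_paths G (verts G) 0"
    unfolding leaves_paths_iff
    by (intro exI[of _ "{}"]) (simp add: path_partition_def partition_on_empty separated_def)
  then have ne: "?I \<noteq> {}" by blast
  let ?D = "(\<lambda>(S, p). int p - int (card S)) ` ?I" and ?P = "(\<lambda>(S, p). p + card S) ` ?I"
  have D: "Delta G = Max ?D" unfolding Delta_def by (rule arg_cong[where f = Max]) (auto simp: image_iff)
  have P: "Delta_plus G = Min ?P" unfolding Delta_plus_def by (rule arg_cong[where f = Min]) (auto simp: image_iff)
  have "Max ?D \<in> ?D" "Min ?P \<in> ?P" using fin ne by (intro Max_in Min_in; simp)+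
  then show "\<exists>S p. S \<subseteq> verts G \<and> leaves_paths G S p \<and> Delta G = int p - int (card S)"
    "\<exists>S p. S \<subseteq> verts G \<and> leaves_paths G S p \<and> Delta_plus G = p + card S"
    unfolding D P by auto
  show "int p - int (card S) \<le> Delta G" if "S \<subseteq> verts G" "leaves_paths G S p"
    unfolding D using fin that by (intro Max_ge) (auto simp: image_iff)
qed

lemma T_minus_attained:
    "\<exists>S. S \<subseteq> verts G \<and> undirected_forest (delete_verts G S) \<and>
       T_minus G = int (path_cover_number (delete_verts G S)) - int (card S)"
  and le_T_minus: "S \<subseteq> verts G \<Longrightarrow> undirected_forest (delete_verts G S) \<Longrightarrow>
       int (path_cover_number (delete_verts G S)) - int (card S) \<le> T_minus G"
  and T_plus_attained:
    "\<exists>S. S \<subseteq> verts G \<and> undirected_forest (delete_verts G S) \<and>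
       T_plus G = path_cover_number (delete_verts G S) + card S"
  and T_plus_le: "S \<subseteq> verts G \<Longrightarrow> undirected_forest (delete_verts G S) \<Longrightarrow>
       T_plus G \<le> path_cover_number (delete_verts G S) + card S"
proof -
  let ?I = "{S. S \<subseteq> verts G \<and> undirected_forest (delete_verts G S)}"
  have fin: "finite ?I" by (rule finite_subset[of _ "Pow (verts G)"]) auto
  have "undirected_forest (delete_verts G (verts G))"
    by (simp add: undirected_forest_delete_verts_iff one_degenerate_def)
  then have ne: "?I \<noteq> {}" by blast
  let ?D = "(\<lambda>S. int (path_cover_number (delete_verts G S)) - int (card S)) ` ?I"
    and ?P = "(\<lambda>S. path_cover_number (delete_verts G S) + card S) ` ?I"
  have D: "T_minus G = Max ?D" unfolding T_minus_def by (rule arg_cong[where f = Max]) auto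
  have P: "T_plus G = Min ?P" unfolding T_plus_def by (rule arg_cong[where f = Min]) auto
  have "Max ?D \<in> ?D" "Min ?P \<in> ?P" using fin ne by (intro Max_in Min_in; simp)+
  then show "\<exists>S. S \<subseteq> verts G \<and> undirected_forest (delete_verts G S) \<and>
       T_minus G = int (path_cover_number (delete_verts G S)) - int (card S)"
    "\<exists>S. S \<subseteq> verts G \<and> undirected_forest (delete_verts G S) \<and>
       T_plus G = path_cover_number (delete_verts G S) + card S"
    unfolding D P by auto
  show "int (path_cover_number (delete_verts G S)) - int (card S) \<le> T_minus G"
    "T_plus G \<le> path_cover_number (delete_verts G S) + card S"
    if "S \<subseteq> verts G" "undirected_forest (delete_verts G S)"
    unfolding D P using fin that by (auto intro: Max_ge Min_le)
qed

text \<open>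
  The paths left by a deletion are the components, and no cover can do with fewer paths than
  components.
\<close>

lemma leaves_paths_imp_forest:
  assumes "leaves_paths G S p"
  shows "undirected_forest (delete_verts G S)" "path_cover_number (delete_verts G S) = p"
proof -
  obtain Q where Q: "path_partition (arcs_ends G) (verts G - S) Q" "separated (arcs_ends G) Q" "card Q = p"
    using assms unfolding leaves_paths_iff by blast
  then show "undirected_forest (delete_verts G S)"
    unfolding undirected_forest_delete_verts_iff by (intro one_degenerate_separated_paths)
  obtain R where R: "path_partition (arcs_ends G) (verts G - S) R" "path_cover_number (delete_verts G S) = card R"
    using ex_path_cover_number by blast
  have "card Q \<le> card R"
    using Q R(1) by (intro card_components_le_path_partition[of "verts G - S"]) (auto simp: path_partition_def)
  then show "path_cover_number (delete_verts G S) = p"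
    using path_cover_number_le[OF Q(1)] R(2) Q(3) by simp
qed

text \<open>
  If \<open>S\<close> attains \<open>T_minus\<close>, add to \<open>S\<close> the set that the duality provides for the forest \<open>G - S\<close>.
\<close>

lemma Delta_eq_T_minus: "Delta G = T_minus G"
proof (rule antisym)
  obtain S p where "S \<subseteq> verts G" "leaves_paths G S p" "Delta G = int p - int (card S)"
    using Delta_attained by blast
  then show "Delta G \<le> T_minus G" using leaves_paths_imp_forest le_T_minus by metis
next
  obtain S where S: "S \<subseteq> verts G" "undirected_forest (delete_verts G S)"
    and T: "T_minus G = int (path_cover_number (delete_verts G S)) - int (card S)"
    using T_minus_attained by blast
  let ?X = "verts G - S" and ?E = "arcs_ends G"
  have "one_degenerate ?E ?X" using S(2) by (simp add: undirected_forest_delete_verts_iff)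
  then obtain S' Q R where "path_dual ?E ?X S' Q R"
    using forest_path_dual[OF sym_arcs_ends irrefl_arcs_ends, of ?X] by auto
  then have S': "S' \<subseteq> ?X" and Q: "path_partition ?E (?X - S') Q" "separated ?E Q"
    and R: "path_partition ?E ?X R" and card: "card R + card S' \<le> card Q"
    by (simp_all add: path_dual_def)
  have "?X - S' = verts G - (S \<union> S')" by blast
  then have "leaves_paths G (S \<union> S') (card Q)" using Q by (auto simp: leaves_paths_iff)
  then have "int (card Q) - int (card (S \<union> S')) \<le> Delta G" using S(1) S' by (intro le_Delta) auto
  moreover have "card (S \<union> S') \<le> card S + card S'" by (rule card_Un_le)
  moreover have "path_cover_number (delete_verts G S) \<le> card R" by (rule path_cover_number_le[OF R])
  ultimately show "T_minus G \<le> Delta G" using card T by linarith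
qed

lemma Delta_le_max_mult: "Delta G \<le> int (max_mult G)"
proof -
  obtain S p where S: "S \<subseteq> verts G" "leaves_paths G S p" "Delta G = int p - int (card S)"
    using Delta_attained by blast
  then obtain Q where "path_partition (arcs_ends G) (verts G - S) Q" "separated (arcs_ends G) Q" "card Q = p"
    unfolding leaves_paths_iff by blast
  then obtain A where "A \<in> sym_mats G" "p - card S \<le> Polynomial.order 0 (char_poly A)"
    using ex_sym_mat_order_ge[OF S(1)] by (auto simp: path_partition_def)
  then have "p - card S \<le> max_mult G" using order_le_max_mult le_trans by blast
  then show ?thesis using S(3) by linarith
qed

lemma max_mult_le_zero_forcing_number: "max_mult G \<le> zero_forcing_number G"
  using max_mult_attained zero_forcing_number_attained order_sym_mat_le_zero_forcing by metis

lemma forces_all: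
  assumes "Z \<subseteq> verts G"
    and "\<And>B. Z \<subseteq> B \<Longrightarrow> B \<subset> verts G \<Longrightarrow> \<exists>u\<in>B. \<exists>v. neighbors G u - B = {v}"
  shows "zero_forcing_set G Z"
proof -
  have "(color_step G)\<^sup>*\<^sup>* B (verts G)" if "Z \<subseteq> B" "B \<subseteq> verts G" for B
    using that
  proof (induction "card (verts G - B)" arbitrary: B rule: less_induct)
    case less
    show ?case
    proof (cases "B = verts G")
      case False
      then obtain u v where uv: "u \<in> B" "neighbors G u - B = {v}" using assms(2)[of B] less.prems by blast
      then have "(u, v) \<in> arcs_ends G" "v \<notin> B" by auto
      then have v: "v \<in> verts G - B" using arcs_ends_subset by auto
      have "color_step G B (insert v B)" using uv by (auto simp: color_step_def)
      moreover have "card (verts G - insert v B) < card (verts G - B)"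
        using v by (intro psubset_card_mono) auto
      then have "(color_step G)\<^sup>*\<^sup>* (insert v B) (verts G)" using less v by (intro less.hyps) auto
      ultimately show ?thesis by (rule converse_rtranclp_into_rtranclp)
    qed simp
  qed
  then show ?thesis using assms(1) by (auto simp: zero_forcing_set_def)
qed

lemma zero_forcing_number_le_T_plus: "zero_forcing_number G \<le> T_plus G"
proof -
  let ?E = "arcs_ends G"
  obtain S where S: "S \<subseteq> verts G" "undirected_forest (delete_verts G S)"
    and T: "T_plus G = path_cover_number (delete_verts G S) + card S"
    using T_plus_attained by blast
  let ?X = "verts G - S"
  obtain R where R: "path_partition ?E ?X R" and cR: "path_cover_number (delete_verts G S) = card R"
    using ex_path_cover_number by blast
  have part: "partition_on ?X R" using R by (simp add: path_partition_def)
  have "\<exists>p. path_list ?E p \<and> set p = C" if "C \<in> R" for C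
    using R that by (auto simp: path_partition_def induces_path_def)
  then obtain pl where pl: "\<And>C. C \<in> R \<Longrightarrow> path_list ?E (pl C) \<and> set (pl C) = C" by metis
  define Z where "Z = S \<union> (\<lambda>C. hd (pl C)) ` R"
  have fR: "finite R" using finite_elements[OF _ part] by simp
  have "zero_forcing_set G Z"
  proof (rule forces_all)
    have "hd (pl C) \<in> ?X" if "C \<in> R" for C
      using pl[OF that] path_list_nonempty hd_in_set partition_onD1[OF part] that by (metis UnionI)
    then show "Z \<subseteq> verts G" using S(1) by (auto simp: Z_def)
    fix B assume B: "Z \<subseteq> B" "B \<subset> verts G"
    show "\<exists>u\<in>B. \<exists>v. neighbors G u - B = {v}"
    proof (rule path_heads_force[OF sym_arcs_ends _ _ part pl])
      show "one_degenerate ?E ?X" using S(2) by (simp add: undirected_forest_delete_verts_iff)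
      show "(\<lambda>C. hd (pl C)) ` R \<subseteq> B" "\<not> ?X \<subseteq> B" using B by (auto simp: Z_def)
      show "{v. (u, v) \<in> ?E} \<subseteq> ?X \<union> B" for u using B(1) arcs_ends_subset by (auto simp: Z_def)
    qed auto
  qed
  then have "zero_forcing_number G \<le> card Z" by (rule zero_forcing_number_le)
  also have "card Z \<le> card S + card R"
    unfolding Z_def using card_Un_le[of S] card_image_le[OF fR, of "\<lambda>C. hd (pl C)"] by (meson add_left_mono le_trans)
  finally show ?thesis using T cR by simp
qed

lemma T_plus_le_Delta_plus: "T_plus G \<le> Delta_plus G"
  using Delta_plus_attained leaves_paths_imp_forest T_plus_le by metis

lemma T_plus_le_T_minus_of_forest:
  assumes "undirected_forest G"
  shows "int (T_plus G) \<le> T_minus G"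
proof -
  have "undirected_forest (delete_verts G {})"
    using undirected_forest_imp_one_degenerate[OF assms] by (simp add: undirected_forest_delete_verts_iff)
  then show ?thesis using le_T_minus[of "{}"] T_plus_le[of "{}"] by force
qed

end

theorem corollary3p9:
  fixes G :: "('a,'b) pre_digraph"
  assumes "graph G"
  shows "Delta G = T_minus G \<and>
         T_minus G \<le> int (max_mult G) \<and>
         max_mult G \<le> zero_forcing_number G \<and>
         zero_forcing_number G \<le> T_plus G \<and>
         T_plus G \<le> Delta_plus G \<and>
         (undirected_forest G \<longrightarrow>
            T_minus G = int (max_mult G) \<and> max_mult G = T_plus G)"
proof -
  interpret graph G by fact
  show ?thesis
    using Delta_eq_T_minus Delta_le_max_mult max_mult_le_zero_forcing_number
      zero_forcing_number_le_T_plus T_plus_le_Delta_plus T_plus_le_T_minus_of_forest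
    by linarith
qed

end
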